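(* Let $(\psi,\vartheta)$ be a cocycle in a separable Hilbert space $\mathbb{H}$ over a dynamical system $(\mathcal{Q},\{\vartheta^t\}_{t\in\mathbb{R}})$ on a metric space $\mathcal{Q}$. Suppose: (i) $P\colon\mathbb{H}\to\mathbb{H}$ is a bounded self-adjoint linear operator and $\mathbb{H}=\mathbb{H}^{+}\oplus\mathbb{H}^{-}$ is an orthogonal direct sum of $P$-invariant subspaces with $P|_{\mathbb{H}^{-}}<0$ and $P|_{\mathbb{H}^{+}}>0$; (ii) $\dim\mathbb{H}^{-}=j$ for some integer $j>0$; (iii) with $V(u):=(Pu,u)$ there are numbers $\delta>0$ and $\nu>0$ such that $$e^{2\nu r}V(\psi^{r}(q,u)-\psi^{r}(q,v))-e^{2\nu l}V(\psi^{l}(q,u)-\psi^{l}(q,v))\le-\delta\int_{l}^{r}e^{2\nu s}|\psi^{s}(q,u)-\psi^{s}(q,v)|^{2}ds$$ for all $u,v\in\mathbb{H}$, $q\in\mathcal{Q}$ and $0\le l\le r$; (iv) for every $q\in\mathcal{Q}$ the amenable set $\mathfrak{A}(q)$ is non-empty; (v) either $P$ is compact, or there exists $t_{com}>0$ such that the map $\psi^{t_{com}}(q,\cdot)\colon\mathbb{H}\to\mathbb{H}$ is compact for every $q\in\mathcal{Q}$. Let $\Pi\colon\mathbb{H}\to\mathbb{H}^{-}$ be the orthogonal projector onto $\mathbb{H}^{-}$. Then for every $q\in\mathcal{Q}$ the map $\Pi_q:=\Pi|_{\mathfrak{A}(q)}\colon\mathfrak{A}(q)\to\mathbb{H}^{-}$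 is a homeomorphism.
   Context: A dynamical system (flow) $(\mathcal{Q},\{\vartheta^t\})$ on a metric space $\mathcal{Q}$ is a continuous action of $\mathbb{R}$ on $\mathcal{Q}$. A cocycle $(\psi,\vartheta)$ in $\mathbb{H}$ over it is a family of maps $\psi^{t}\colon\mathcal{Q}\times\mathbb{H}\to\mathbb{H}$, $t\ge0$, such that $\psi^{0}(q,u)=u$; $\psi^{t+s}(q,u)=\psi^{t}(\vartheta^{s}(q),\psi^{s}(q,u))$ for all $u\in\mathbb{H}$, $q\in\mathcal{Q}$, $t,s\ge0$; and $(t,q,u)\mapsto\psi^{t}(q,u)$ is continuous on $\mathbb{R}_{+}\times\mathcal{Q}\times\mathbb{H}$. $P|_{E}<0$ (resp. $>0$) means $(Pu,u)<0$ (resp. $>0$) for all non-zero $u\in E$. A (possibly nonlinear) compact map sends bounded sets to relatively compact sets. A complete trajectory at $q$ is a continuous map $u\colon\mathbb{R}\to\mathbb{H}$ with $u(t+s)=\psi^{t}(\vartheta^{s}(q),u(s))$ for all $t\ge0$, $s\in\mathbb{R}$; it is said to pass through $u(0)$ at $q$. With $\nu$ the number from (iii), a complete trajectory is amenable if $\int_{-\infty}^{0}e^{2\nu s}|u(s)|^{2}ds<\infty$. The amenable set $\mathfrak{A}(q)$ is the set of all $u_0\in\mathbb{H}$ such that some amenable trajectory passes through $u_0$ at $q$; it carries the topology induced from $\mathbb{H}$. *)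

theory Defs
  imports "HOL-Analysis.Analysis"
begin

definition flow :: "(real \<Rightarrow> 'q::metric_space \<Rightarrow> 'q) \<Rightarrow> bool" where
  "flow \<theta> \<longleftrightarrow>
     (\<forall>q. \<theta> 0 q = q) \<and>
     (\<forall>t s q. \<theta> (t + s) q = \<theta> t (\<theta> s q)) \<and>
     continuous_on UNIV (\<lambda>(t, q). \<theta> t q)"

text \<open>The values of \<open>\<psi> t\<close> for \<open>t < 0\<close> are junk: they are never constrained or used.\<close>

definition cocycle ::
  "(real \<Rightarrow> 'q::metric_space \<Rightarrow> 'h::real_normed_vector \<Rightarrow> 'h) \<Rightarrow> (real \<Rightarrow> 'q \<Rightarrow> 'q) \<Rightarrow> bool" where
  "cocycle \<psi> \<theta> \<longleftrightarrow>
     flow \<theta> \<and>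
     (\<forall>q u. \<psi> 0 q u = u) \<and>
     (\<forall>t\<ge>0. \<forall>s\<ge>0. \<forall>q u. \<psi> (t + s) q u = \<psi> t (\<theta> s q) (\<psi> s q u)) \<and>
     continuous_on ({0..} \<times> UNIV \<times> UNIV) (\<lambda>(t, q, u). \<psi> t q u)"

definition self_adjoint :: "('h::real_inner \<Rightarrow> 'h) \<Rightarrow> bool" where
  "self_adjoint P \<longleftrightarrow> (\<forall>u v. P u \<bullet> v = u \<bullet> P v)"

definition quad_form :: "('h::real_inner \<Rightarrow> 'h) \<Rightarrow> 'h \<Rightarrow> real" where
  "quad_form P u = P u \<bullet> u"

definition negative_on :: "('h::real_inner \<Rightarrow> 'h) \<Rightarrow> 'h set \<Rightarrow> bool" where
  "negative_on P E \<longleftrightarrow> (\<forall>u\<in>E. u \<noteq> 0 \<longrightarrow> P u \<bullet> u < 0)"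

definition positive_on :: "('h::real_inner \<Rightarrow> 'h) \<Rightarrow> 'h set \<Rightarrow> bool" where
  "positive_on P E \<longleftrightarrow> (\<forall>u\<in>E. u \<noteq> 0 \<longrightarrow> P u \<bullet> u > 0)"

text \<open>Trivial intersection and closedness of the two summands follow from orthogonality:
  each summand is the orthogonal complement of the other.\<close>

definition orthogonal_direct_sum :: "'h::real_inner set \<Rightarrow> 'h set \<Rightarrow> bool" where
  "orthogonal_direct_sum E F \<longleftrightarrow>
     subspace E \<and> subspace F \<and>
     (\<forall>x\<in>E. \<forall>y\<in>F. orthogonal x y) \<and>
     (\<forall>u. \<exists>x\<in>E. \<exists>y\<in>F. u = x + y)"

definition orthogonal_projector :: "'h::real_inner set \<Rightarrow> 'h \<Rightarrow> 'h" where
  "orthogonal_projector E u = (THE y. y \<in> E \<and> (\<forall>z\<in>E. orthogonal (u - y) z))"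

lemma orthogonal_projector_unique:
  assumes "subspace E" "y \<in> E" "\<forall>z\<in>E. orthogonal (u - y) z"
  shows "orthogonal_projector E u = y"
  unfolding orthogonal_projector_def
proof (rule the_equality)
  show "y \<in> E \<and> (\<forall>z\<in>E. orthogonal (u - y) z)"
    using assms by blast
next
  fix x assume x: "x \<in> E \<and> (\<forall>z\<in>E. orthogonal (u - x) z)"
  have "x - y \<in> E"
    using assms x by (simp add: subspace_diff)
  then have "(u - y) \<bullet> (x - y) = 0" "(u - x) \<bullet> (x - y) = 0"
    using assms x by (auto simp: orthogonal_def)
  then have "(x - y) \<bullet> (x - y) = 0"
    by (simp add: inner_diff_left)
  then show "x = y"
    by simp
qed

lemma orthogonal_projector_sum:
  assumes "orthogonal_direct_sum E F" "x \<in> E" "y \<in> F"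
  shows "orthogonal_projector F (x + y) = y"
  using assms by (intro orthogonal_projector_unique) (auto simp: orthogonal_direct_sum_def)

definition compact_map :: "('a::metric_space \<Rightarrow> 'b::metric_space) \<Rightarrow> bool" where
  "compact_map f \<longleftrightarrow> (\<forall>B. bounded B \<longrightarrow> compact (closure (f ` B)))"

definition complete_trajectory ::
  "(real \<Rightarrow> 'q::metric_space \<Rightarrow> 'h::real_normed_vector \<Rightarrow> 'h) \<Rightarrow> (real \<Rightarrow> 'q \<Rightarrow> 'q) \<Rightarrow> 'q
    \<Rightarrow> (real \<Rightarrow> 'h) \<Rightarrow> bool" where
  "complete_trajectory \<psi> \<theta> q u \<longleftrightarrow>
     continuous_on UNIV u \<and>
     (\<forall>t\<ge>0. \<forall>s. u (t + s) = \<psi> t (\<theta> s q) (u s))"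

definition amenable_trajectory ::
  "(real \<Rightarrow> 'q::metric_space \<Rightarrow> 'h::real_normed_vector \<Rightarrow> 'h) \<Rightarrow> (real \<Rightarrow> 'q \<Rightarrow> 'q) \<Rightarrow> real \<Rightarrow> 'q
    \<Rightarrow> (real \<Rightarrow> 'h) \<Rightarrow> bool" where
  "amenable_trajectory \<psi> \<theta> \<nu> q u \<longleftrightarrow>
     complete_trajectory \<psi> \<theta> q u \<and>
     set_integrable lborel {..0} (\<lambda>s. exp (2 * \<nu> * s) * (norm (u s))\<^sup>2)"

definition amenable_set ::
  "(real \<Rightarrow> 'q::metric_space \<Rightarrow> 'h::real_normed_vector \<Rightarrow> 'h) \<Rightarrow> (real \<Rightarrow> 'q \<Rightarrow> 'q) \<Rightarrow> real \<Rightarrow> 'q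
    \<Rightarrow> 'h set" where
  "amenable_set \<psi> \<theta> \<nu> q = {u\<^sub>0. \<exists>u. amenable_trajectory \<psi> \<theta> \<nu> q u \<and> u 0 = u\<^sub>0}"

end

(*
  Let u, v be two trajectories at q, w = u - v, and V(w) = (Pw, w) >= -K |Pi w|^2 with K = norm P.
  If both are amenable, the squeezing inequality on [l, 0] with l -> -infinity along times where
  e^(2 nu l) |w(l)|^2 is small gives
    delta * int_{-infinity}^0 e^(2 nu s) |w(s)|^2 ds <= -V(w(0)) <= K |Pi w(0)|^2.
  Closeness of the projections therefore forces closeness of the trajectories in a weighted L^2 norm,
  hence (along subsequences) at some time in [-1, 0], hence at time 0 by continuity of the cocycle.
  This yields injectivity of Pi on the amenable set and continuity of its inverse.

  For surjectivity, fix an amenable trajectory v and a target zeta in H^-. For eta in H^-, the map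
  sending eta to the projection at time 0 of the trajectory started from v(-k) + eta at time -k expands
  distances up to a constant, so it is onto H^- by invariance of domain; let x_k be the trajectory that
  hits zeta. Since V <= 0 at time -k, the weighted energies of x_k - v on [-k, 0] are bounded uniformly
  in k. By Fatou's lemma a subsequence is bounded at some fixed time, and either compactness hypothesis
  turns this into convergence at a fixed, arbitrarily early time. A diagonal sequence converges to an
  amenable trajectory through the fibre over zeta.
*)
theory Submission
  imports Defs "HOL-Homology.Invariance_of_Domain" "HOL-Library.Diagonal_Subsequence"
begin

subsection \<open>Finite-dimensional subspaces of an inner product space\<close>

text \<open>Since \<open>card\<close> is 0 on infinite sets, a positive \<open>dim\<close> encodes
  finite dimension as well as nontriviality. Coordinates with respect to \<open>b\<close> stand in
  for a Euclidean structure on \<open>S\<close>.\<close>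

lemma finite_dim_orthonormal_sequence:
  fixes S :: "'h::real_inner set"
  assumes S: "subspace S" and dim: "dim S > 0"
  obtains b :: "nat \<Rightarrow> 'h" and n where
    "\<And>i k. i < n \<Longrightarrow> k < n \<Longrightarrow> b i \<bullet> b k = (if i = k then 1 else 0)"
    "S = span (b ` {..<n})"
proof -
  obtain B where B: "independent B" "span B = span S"
    using dim unfolding real_vector.dim_def by (auto split: if_splits)
  have "card B = dim S"
    using B by (metis real_vector.dim_eq_card)
  then have "finite B"
    using dim card_ge_0_finite by force
  then obtain C where C: "finite C" "span C = span B" "pairwise orthogonal C"
    using basis_orthogonal by blast
  define D where "D = C - {0}"
  have D: "finite D" "span D = S" "pairwise orthogonal D" "0 \<notin> D"
    using C B S by (auto simp: D_def span_delete_0 pairwise_def)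
  obtain e where e: "bij_betw e {..<card D} D"
    using D(1) by (metis ex_bij_betw_nat_finite lessThan_atLeast0)
  define b where "b i = e i /\<^sub>R norm (e i)" for i
  have eD: "e i \<in> D" if "i < card D" for i
    using e that by (auto simp: bij_betw_def)
  have "span (b ` {..<card D}) = S"
  proof -
    have "e i \<in> span (b ` {..<card D})" if "i < card D" for i
    proof -
      have "e i = norm (e i) *\<^sub>R b i"
        using eD[OF that] D(4) by (cases "e i = 0") (auto simp: b_def)
      then show ?thesis
        using that by (metis imageI lessThan_iff span_base span_mul)
    qed
    then have "D \<subseteq> span (b ` {..<card D})"
      using bij_betw_imp_surj_on[OF e] by (metis image_subsetI lessThan_iff)
    moreover have "b ` {..<card D} \<subseteq> span D"
      using eD by (auto simp: b_def span_base span_mul)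
    ultimately show ?thesis
      using D(2) by (metis span_eq)
  qed
  moreover have "b i \<bullet> b k = (if i = k then 1 else 0)" if "i < card D" "k < card D" for i k
  proof (cases "i = k")
    case True
    then show ?thesis
      using eD[OF that(1)] D(4) by (auto simp: b_def dot_square_norm power2_eq_square field_simps)
  next
    case False
    then have "e i \<noteq> e k"
      using e that by (auto simp: bij_betw_def inj_on_def)
    then have "e i \<bullet> e k = 0"
      using D(3) eD that by (auto simp: pairwise_def orthogonal_def)
    then show ?thesis
      using False by (simp add: b_def)
  qed
  ultimately show ?thesis
    using that[of "card D" b] by blast
qed

text \<open>The defect \<open>d\<close> lies in the span and is orthogonal to every basis vector,
  hence to itself.\<close>

lemma orthonormal_expansion:
  fixes b :: "nat \<Rightarrow> 'h::real_inner"
  assumes b: "\<And>i k. i < n \<Longrightarrow> k < n \<Longrightarrow> b i \<bullet> b k = (if i = k then 1 else 0)"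
    and u: "u \<in> span (b ` {..<n})"
  shows "(\<Sum>i<n. (u \<bullet> b i) *\<^sub>R b i) = u"
proof -
  define d where "d = u - (\<Sum>i<n. (u \<bullet> b i) *\<^sub>R b i)"
  have "d \<in> span (b ` {..<n})"
    unfolding d_def by (intro span_diff u span_sum span_mul span_base) auto
  moreover have "orthogonal d (b k)" if "k < n" for k
  proof -
    have "(\<Sum>i<n. (u \<bullet> b i) *\<^sub>R b i) \<bullet> b k = (\<Sum>i<n. (u \<bullet> b i) * (if i = k then 1 else 0))"
      unfolding inner_sum_left by (intro sum.cong) (auto simp: b that)
    also have "\<dots> = u \<bullet> b k"
      using that by (simp add: if_distrib cong: if_cong)
    finally show ?thesis
      by (simp add: d_def orthogonal_def inner_diff_left)
  qed
  ultimately have "orthogonal d d"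
    using orthogonal_to_span[of d "b ` {..<n}" d] by blast
  then show ?thesis
    by (simp add: d_def orthogonal_def)
qed

text \<open>By the orthonormal expansion, \<open>S\<close> is the fixed-point set of a continuous
  map.\<close>

lemma finite_dim_subspace_closed:
  fixes S :: "'h::real_inner set"
  assumes S: "subspace S" and dim: "dim S > 0"
  shows "closed S"
proof -
  obtain b :: "nat \<Rightarrow> 'h" and n where
    b: "\<And>i k. i < n \<Longrightarrow> k < n \<Longrightarrow> b i \<bullet> b k = (if i = k then 1 else 0)"
    and Sb: "S = span (b ` {..<n})"
    using finite_dim_orthonormal_sequence[OF assms] by metis
  have "S = {u. (\<Sum>i<n. (u \<bullet> b i) *\<^sub>R b i) = u}"
  proof safe
    fix u assume "(\<Sum>i<n. (u \<bullet> b i) *\<^sub>R b i) = u"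
    moreover have "(\<Sum>i<n. (u \<bullet> b i) *\<^sub>R b i) \<in> S"
      unfolding Sb by (intro span_sum span_mul span_base) auto
    ultimately show "u \<in> S" by simp
  next
    fix u assume "u \<in> S"
    then show "(\<Sum>i<n. (u \<bullet> b i) *\<^sub>R b i) = u"
      using b Sb by (intro orthonormal_expansion) auto
  qed
  then show ?thesis
    using closed_Collect_eq[of "\<lambda>u. \<Sum>i<n. (u \<bullet> b i) *\<^sub>R b i" "\<lambda>u. u"]
    by (simp add: continuous_intros)
qed

text \<open>Bolzano-Weierstrass one coordinate at a time; each induction step refines the previous
  subsequence.\<close>

lemma bounded_coordinates_convergent_subseq:
  fixes f :: "nat \<Rightarrow> nat \<Rightarrow> real"
  assumes "\<And>i. i < n \<Longrightarrow> bounded (range (\<lambda>k. f k i))"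
  shows "\<exists>r. strict_mono (r :: nat \<Rightarrow> nat) \<and> (\<forall>i<n. convergent (\<lambda>k. f (r k) i))"
  using assms
proof (induction n)
  case 0
  then show ?case
    by (intro exI[of _ "\<lambda>k. k"]) (auto simp: strict_mono_def)
next
  case (Suc n)
  have "\<exists>r. strict_mono (r :: nat \<Rightarrow> nat) \<and> (\<forall>i<n. convergent (\<lambda>k. f (r k) i))"
    by (rule Suc.IH) (simp add: Suc.prems)
  then obtain r where r: "strict_mono (r :: nat \<Rightarrow> nat)" "\<And>i. i < n \<Longrightarrow> convergent (\<lambda>k. f (r k) i)"
    by blast
  have "bounded (range (\<lambda>k. f (r k) n))"
    using Suc.prems[of n] by (rule bounded_subset) auto
  then obtain l r' where r': "strict_mono (r' :: nat \<Rightarrow> nat)" "(\<lambda>k. f (r (r' k)) n) \<longlonglongrightarrow> l"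
    using bounded_imp_convergent_subsequence[of "\<lambda>k. f (r k) n"] by (auto simp: o_def)
  show ?case
  proof (intro exI[of _ "r \<circ> r'"] conjI allI impI)
    fix i assume "i < Suc n"
    then show "convergent (\<lambda>k. f ((r \<circ> r') k) i)"
      using r(2)[of i] r' convergent_subseq_convergent[OF r(2)[of i] r'(1)]
      by (cases "i = n") (auto simp: o_def convergent_def)
  qed (use r r' strict_mono_o in blast)
qed

lemma finite_dim_subspace_compact_sphere:
  fixes S :: "'h::real_inner set"
  assumes S: "subspace S" and dim: "dim S > 0"
  shows "compact (S \<inter> sphere 0 1)"
  unfolding compact_def
proof (intro allI impI)
  fix f :: "nat \<Rightarrow> 'h" assume f: "\<forall>k. f k \<in> S \<inter> sphere 0 1"
  obtain b :: "nat \<Rightarrow> 'h" and n where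
    b: "\<And>i k. i < n \<Longrightarrow> k < n \<Longrightarrow> b i \<bullet> b k = (if i = k then 1 else 0)"
    and Sb: "S = span (b ` {..<n})"
    using finite_dim_orthonormal_sequence[OF assms] by metis
  have "bounded (range (\<lambda>k. f k \<bullet> b i))" if "i < n" for i
  proof (rule boundedI)
    fix y assume "y \<in> range (\<lambda>k. f k \<bullet> b i)"
    then obtain k where "y = f k \<bullet> b i" by auto
    then show "norm y \<le> 1 * norm (b i)"
      using Cauchy_Schwarz_ineq2[of "f k" "b i"] f by simp
  qed
  then obtain r where r: "strict_mono (r :: nat \<Rightarrow> nat)"
    and conv: "\<forall>i<n. convergent (\<lambda>k. f (r k) \<bullet> b i)"
    using bounded_coordinates_convergent_subseq[of n "\<lambda>k i. f k \<bullet> b i"] by auto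
  obtain l where l: "\<And>i. i < n \<Longrightarrow> (\<lambda>k. f (r k) \<bullet> b i) \<longlonglongrightarrow> l i"
    using conv unfolding convergent_def by metis
  have "(\<lambda>k. \<Sum>i<n. (f (r k) \<bullet> b i) *\<^sub>R b i) \<longlonglongrightarrow> (\<Sum>i<n. l i *\<^sub>R b i)"
    by (intro tendsto_sum tendsto_scaleR l tendsto_const) auto
  then have lim: "(f \<circ> r) \<longlonglongrightarrow> (\<Sum>i<n. l i *\<^sub>R b i)"
  proof -
    have "(\<Sum>i<n. (f (r k) \<bullet> b i) *\<^sub>R b i) = f (r k)" for k
      using b f Sb by (intro orthonormal_expansion) auto
    then show ?thesis
      using \<open>(\<lambda>k. \<Sum>i<n. (f (r k) \<bullet> b i) *\<^sub>R b i) \<longlonglongrightarrow> (\<Sum>i<n. l i *\<^sub>R b i)\<close>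
      by (simp add: o_def)
  qed
  have "closed (S \<inter> sphere 0 1)"
  proof (rule closed_Int)
    have "sphere 0 1 = {x :: 'h. norm x = 1}"
      by (auto simp: sphere_def)
    then show "closed (sphere (0::'h) 1)"
      using closed_Collect_eq[of norm "\<lambda>x::'h. 1"] by (simp add: continuous_intros)
  qed (rule finite_dim_subspace_closed[OF assms])
  then have "(\<Sum>i<n. l i *\<^sub>R b i) \<in> S \<inter> sphere 0 1"
    using closed_sequentially[OF _ _ lim] f by (metis comp_apply)
  then show "\<exists>l\<in>S \<inter> sphere 0 1. \<exists>r. strict_mono r \<and> (f \<circ> r) \<longlonglongrightarrow> l"
    using r lim by blast
qed

text \<open>On the compact unit sphere of \<open>S\<close> the function \<open>g\<close> attains a
  positive minimum, which serves as \<open>c\<close>. Homogeneity of degree two carries the bound to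
  all of \<open>S\<close>.\<close>

lemma negative_on_finite_dim_coercive:
  fixes S :: "'h::real_inner set"
  assumes S: "subspace S" and dim: "dim S > 0"
    and P: "bounded_linear P" and neg: "negative_on P S"
  obtains c where "c > 0" "\<And>x. x \<in> S \<Longrightarrow> c * (norm x)\<^sup>2 \<le> - quad_form P x"
proof -
  interpret P: bounded_linear P by (rule P)
  define g where "g x = - quad_form P x" for x
  have gcont: "continuous_on A g" for A
    unfolding g_def quad_form_def by (intro continuous_intros P.continuous_on)
  have unit: "x /\<^sub>R norm x \<in> S \<inter> sphere 0 1" if "x \<in> S" "x \<noteq> 0" for x
    using that S by (auto simp: subspace_scale)
  obtain x where "x \<in> S" "x \<noteq> 0"
  proof -
    have "\<not> S \<subseteq> {0}"
    proof
      assume "S \<subseteq> {0}"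
      then have "S = {0}"
        using subspace_0[OF S] by auto
      then have "span S = span {}"
        by simp
      then have "dim S = card ({} :: 'h set)"
        by (intro real_vector.dim_eq_card) (auto simp: independent_empty)
      then show False using dim by simp
    qed
    then show ?thesis using that by blast
  qed
  then have "S \<inter> sphere 0 1 \<noteq> {}"
    using unit by blast
  then obtain z where z: "z \<in> S \<inter> sphere 0 1" "\<And>y. y \<in> S \<inter> sphere 0 1 \<Longrightarrow> g z \<le> g y"
    using continuous_attains_inf[OF finite_dim_subspace_compact_sphere[OF S dim] _ gcont] by blast
  have "z \<noteq> 0"
    using z(1) by auto
  then have "g z > 0"
    using z(1) neg by (auto simp: negative_on_def g_def quad_form_def)
  moreover have "g z * (norm x)\<^sup>2 \<le> g x" if "x \<in> S" for x
  proof (cases "x = 0")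
    case False
    have "g z \<le> g (x /\<^sub>R norm x)"
      using z(2) unit[OF that False] by blast
    also have "\<dots> = g x / (norm x)\<^sup>2"
      by (simp add: g_def quad_form_def P.scaleR power2_eq_square divide_inverse mult_ac)
    finally show ?thesis
      using False by (simp add: pos_le_divide_eq)
  qed (simp add: g_def quad_form_def)
  ultimately show ?thesis
    using that unfolding g_def by blast
qed

text \<open>The image is closed by the lower bound and open by invariance of domain.\<close>

lemma expanding_self_map_surjective:
  fixes S :: "'h::{real_inner, complete_space} set"
  assumes S: "subspace S" and dim: "dim S > 0"
    and cont: "continuous_on S F" and FS: "F ` S \<subseteq> S"
    and c: "c > 0" and expand: "\<And>x y. x \<in> S \<Longrightarrow> y \<in> S \<Longrightarrow> c * norm (x - y) \<le> norm (F x - F y)"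
  shows "F ` S = S"
proof -
  obtain b :: "nat \<Rightarrow> 'h" and n where
    b: "\<And>i k. i < n \<Longrightarrow> k < n \<Longrightarrow> b i \<bullet> b k = (if i = k then 1 else 0)"
    and Sb: "S = span (b ` {..<n})"
    using finite_dim_orthonormal_sequence[OF S dim] by metis
  \<comment> \<open>\<open>E\<close> is the carrier of \<open>Euclidean_space n\<close>, for which
    invariance of domain is stated. The coordinate maps \<open>T\<close> and \<open>C\<close>
    transport \<open>F\<close> to a self-map of \<open>E\<close>.\<close>
  define E where "E = {x :: nat \<Rightarrow> real. \<forall>i\<ge>n. x i = 0}"
  have topE: "Euclidean_space n = top_of_set E"
    by (simp add: E_def Euclidean_space_def euclidean_product_topology)
  define T :: "(nat \<Rightarrow> real) \<Rightarrow> 'h" where "T x = (\<Sum>i<n. x i *\<^sub>R b i)" for x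
  define C :: "'h \<Rightarrow> nat \<Rightarrow> real" where "C u i = (if i < n then u \<bullet> b i else 0)" for u i
  have TC: "T (C u) = u" if "u \<in> S" for u
    using orthonormal_expansion[where u = u and n = n and b = b] b that Sb by (simp add: T_def C_def)
  have CT: "C (T x) = x" if "x \<in> E" for x
  proof
    fix k
    show "C (T x) k = x k"
    proof (cases "k < n")
      case True
      have "T x \<bullet> b k = (\<Sum>i<n. x i * (if i = k then 1 else 0))"
        unfolding T_def inner_sum_left by (intro sum.cong) (auto simp: b True)
      then show ?thesis
        using True by (simp add: C_def if_distrib cong: if_cong)
    qed (use that in \<open>auto simp: C_def E_def\<close>)
  qed
  have TS: "T x \<in> S" for x
    unfolding T_def Sb by (intro span_sum span_mul span_base) auto
  have CE: "C u \<in> E" for u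
    by (auto simp: C_def E_def)
  have Tcont: "continuous_on A T" for A
  proof -
    have "continuous_on A (\<lambda>x :: nat \<Rightarrow> real. x i)" for i
      by (rule continuous_on_product_then_coordinatewise[OF continuous_on_id])
    then show ?thesis
      unfolding T_def by (intro continuous_intros)
  qed
  have Ccont: "continuous_on A C" for A
  proof (rule continuous_on_coordinatewise_then_product)
    fix i show "continuous_on A (\<lambda>u. C u i)"
      by (cases "i < n") (auto simp: C_def intro!: continuous_intros)
  qed
  have hom: "homeomorphism E S T C"
    unfolding homeomorphism_def
  proof (intro conjI)
    show "T ` E = S"
      using TS TC[symmetric] CE by auto
    show "C ` S = E"
      using TS CT[symmetric] CE by auto
  qed (use TC CT Tcont Ccont in auto)
  have inj: "inj_on F S"
  proof (rule inj_onI)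
    fix x y assume "x \<in> S" "y \<in> S" "F x = F y"
    then have "c * norm (x - y) \<le> 0"
      using expand[of x y] by simp
    then show "x = y"
      using c by (simp add: mult_le_0_iff)
  qed
  have "openin (Euclidean_space n) ((C \<circ> F \<circ> T) ` E)"
  proof (rule invariance_of_domain_Euclidean_space)
    have "continuous_on E (C \<circ> F \<circ> T)"
      using TS by (intro continuous_on_compose Tcont Ccont continuous_on_subset[OF cont]) auto
    then show "continuous_map (subtopology (Euclidean_space n) E) (Euclidean_space n) (C \<circ> F \<circ> T)"
      unfolding topE using CE by (auto simp: subtopology_subtopology)
    show "openin (Euclidean_space n) E"
      unfolding topE by auto
    show "inj_on (C \<circ> F \<circ> T) E"
    proof (rule inj_onI)
      fix x y assume xy: "x \<in> E" "y \<in> E" "(C \<circ> F \<circ> T) x = (C \<circ> F \<circ> T) y"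
      then have "T (C (F (T x))) = T (C (F (T y)))"
        by simp
      moreover have "F (T x) \<in> S" "F (T y) \<in> S"
        using FS TS by blast+
      ultimately have "F (T x) = F (T y)"
        by (simp add: TC)
      then have "T x = T y"
        using inj TS by (meson inj_onD)
      then show "x = y"
        using CT xy by metis
    qed
  qed
  moreover have "F ` S = T ` ((C \<circ> F \<circ> T) ` E)"
  proof -
    have "T ` ((C \<circ> F \<circ> T) ` E) = (\<lambda>u. T (C (F u))) ` (T ` E)"
      by (simp add: image_image)
    also have "T ` E = S"
      using hom by (simp add: homeomorphism_def)
    also have "(\<lambda>u. T (C (F u))) ` S = F ` S"
      using FS TC by (intro image_cong) auto
    finally show ?thesis by simp
  qed
  ultimately have op: "openin (top_of_set S) (F ` S)"
    using homeomorphism_imp_open_map[OF hom] topE by simp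
  have "closed (F ` S)"
    unfolding closed_sequential_limits
  proof (intro allI impI, elim conjE)
    fix f y assume fS: "\<forall>k. f k \<in> F ` S" and lim: "f \<longlonglongrightarrow> y"
    obtain x where x: "\<And>k. x k \<in> S" "\<And>k. f k = F (x k)"
      using fS choice[of "\<lambda>k z. z \<in> S \<and> f k = F z"] by blast
    \<comment> \<open>The expansion bound turns a Cauchy sequence of values into a Cauchy sequence
      of preimages.\<close>
    have "Cauchy x"
    proof (rule metric_CauchyI)
      fix e :: real assume "e > 0"
      then have "c * e > 0" using c by simp
      then obtain N where N: "\<And>m k. m \<ge> N \<Longrightarrow> k \<ge> N \<Longrightarrow> dist (f m) (f k) < c * e"
        using LIMSEQ_imp_Cauchy[OF lim] unfolding Cauchy_def by blast
      have "dist (x m) (x k) < e" if "m \<ge> N" "k \<ge> N" for m k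
      proof -
        have "c * norm (x m - x k) < c * e"
          using expand[OF x(1) x(1), of m k] N[OF that] by (simp add: x(2) dist_norm)
        then show ?thesis
          using c by (simp add: dist_norm)
      qed
      then show "\<exists>M. \<forall>m\<ge>M. \<forall>n\<ge>M. dist (x m) (x n) < e"
        by blast
    qed
    then obtain z where z: "x \<longlonglongrightarrow> z"
      using Cauchy_convergent convergent_def by blast
    have "z \<in> S"
      using closed_sequentially[OF finite_dim_subspace_closed[OF S dim] _ z] x(1) by blast
    then have "f \<longlonglongrightarrow> F z"
      using continuous_on_tendsto_compose[OF cont z \<open>z \<in> S\<close>] x(1) by (simp flip: x(2))
    then show "y \<in> F ` S"
      using \<open>z \<in> S\<close> lim LIMSEQ_unique by blast
  qed
  then have "closedin (top_of_set S) (F ` S)"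
    using FS by (rule closed_subset[rotated])
  moreover have "connected S"
    using S by (simp add: convex_connected subspace_imp_convex)
  moreover have "F ` S \<noteq> {}"
    using subspace_0[OF S] by auto
  ultimately show ?thesis
    using op connected_clopen by blast
qed

subsection \<open>Pointwise bounds from integral bounds\<close>

text \<open>A function with finite integral is finite almost everywhere, and \<open>A\<close> is not
  a null set.\<close>

lemma ex_finite_value:
  fixes h :: "'a \<Rightarrow> ennreal"
  assumes h: "(\<lambda>x. h x * indicator A x) \<in> borel_measurable M"
    and A: "A \<in> sets M" "emeasure M A \<noteq> 0" and fin: "(\<integral>\<^sup>+x\<in>A. h x \<partial>M) < \<infinity>"
  shows "\<exists>x\<in>A. h x < \<infinity>"
proof (rule ccontr)
  assume neg: "\<not> (\<exists>x\<in>A. h x < \<infinity>)"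
  have "AE x in M. h x * indicator A x \<noteq> \<infinity>"
    using fin by (intro nn_integral_PInf_AE h) simp
  then have "AE x in M. x \<notin> A"
    by (rule AE_mp) (use neg in \<open>auto intro!: AE_I2 simp: indicator_def less_top\<close>)
  then show False
    using A by (subst (asm) AE_iff_measurable[OF A(1)]) (auto dest: sets.sets_into_space)
qed

text \<open>By Fatou the liminf has a finite integral, so it is finite at some \<open>x\<close>. Any
  \<open>B\<close> above its value there exceeds \<open>f k x\<close> for infinitely many
  \<open>k\<close>, and these indices form the subsequence.\<close>

lemma bounded_integrals_pointwise_bounded_subseq:
  fixes f :: "nat \<Rightarrow> 'a \<Rightarrow> ennreal"
  assumes f: "\<And>k. (\<lambda>x. f k x * indicator A x) \<in> borel_measurable M"
    and A: "A \<in> sets M" "emeasure M A \<noteq> 0"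
    and C: "\<And>k. (\<integral>\<^sup>+x\<in>A. f k x \<partial>M) \<le> C" "C < \<infinity>"
  shows "\<exists>x\<in>A. \<exists>B<\<infinity>. \<exists>r. strict_mono (r :: nat \<Rightarrow> nat) \<and> (\<forall>k. f (r k) x \<le> B)"
proof -
  let ?h = "\<lambda>x. liminf (\<lambda>k. f k x * indicator A x)"
  have meas: "?h \<in> borel_measurable M"
    by (intro borel_measurable_liminf f)
  \<comment> \<open>The indicator sits inside the liminf because \<open>f k\<close> is assumed
    measurable only after restriction to \<open>A\<close>; off \<open>A\<close> the liminf is
    0.\<close>
  have eq: "?h x * indicator A x = ?h x" for x
    by (cases "x \<in> A") (auto simp: Liminf_const)
  have "(\<integral>\<^sup>+x\<in>A. ?h x \<partial>M) \<le> liminf (\<lambda>k. \<integral>\<^sup>+x\<in>A. f k x \<partial>M)"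
    unfolding eq by (intro nn_integral_liminf f)
  also have "\<dots> \<le> C"
    by (rule Liminf_le) (auto simp: C)
  finally have "\<exists>x\<in>A. ?h x < \<infinity>"
    using meas C by (intro ex_finite_value[OF _ A]) (auto simp: eq intro: le_less_trans)
  then obtain x where x: "x \<in> A" "?h x < \<infinity>"
    by blast
  then obtain B where B: "?h x < B" "B < \<infinity>"
    using dense by blast
  have "\<not> (\<forall>\<^sub>F k in sequentially. B \<le> f k x * indicator A x)"
  proof
    assume "\<forall>\<^sub>F k in sequentially. B \<le> f k x * indicator A x"
    then have "B \<le> ?h x"
      by (rule Liminf_bounded)
    then show False
      using B(1) by simp
  qed
  then have "infinite {k. f k x < B}"
    using x(1) by (simp add: not_eventually frequently_cofinite cofinite_eq_sequentially[symmetric] not_le)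
  then have "strict_mono (enumerate {k. f k x < B})" "\<And>k. f (enumerate {k. f k x < B} k) x \<le> B"
    using enumerate_in_set by (fastforce simp: strict_mono_enumerate less_imp_le)+
  then show ?thesis
    using x(1) B(2) by blast
qed

text \<open>With weights \<open>2 ^ k\<close> the integrals are still dominated by the summable
  \<open>(1/2) ^ k\<close>. The weighted series is therefore finite at some common \<open>x\<close>,
  and its value bounds each term.\<close>

lemma geometric_integrals_pointwise_geometric:
  fixes f :: "nat \<Rightarrow> 'a \<Rightarrow> ennreal"
  assumes f: "\<And>k. (\<lambda>x. f k x * indicator A x) \<in> borel_measurable M"
    and A: "A \<in> sets M" "emeasure M A \<noteq> 0"
    and C: "\<And>k. (\<integral>\<^sup>+x\<in>A. f k x \<partial>M) \<le> ennreal ((1/4) ^ k)"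
  shows "\<exists>x\<in>A. \<exists>B<\<infinity>. \<forall>k. ennreal (2 ^ k) * f k x \<le> B"
proof -
  let ?h = "\<lambda>x. suminf (\<lambda>k. ennreal (2 ^ k) * (f k x * indicator A x))"
  have [measurable]: "(\<lambda>x. f k x * indicator A x) \<in> borel_measurable M" for k
    by (rule f)
  have meas: "?h \<in> borel_measurable M"
    by measurable
  have eq: "?h x * indicator A x = ?h x" for x
    by (cases "x \<in> A") auto
  have "(\<integral>\<^sup>+x\<in>A. ?h x \<partial>M) = suminf (\<lambda>k. \<integral>\<^sup>+x. ennreal (2 ^ k) * (f k x * indicator A x) \<partial>M)"
    unfolding eq by (intro nn_integral_suminf) measurable
  also have "\<dots> = suminf (\<lambda>k. ennreal (2 ^ k) * (\<integral>\<^sup>+x\<in>A. f k x \<partial>M))"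
    by (intro suminf_cong nn_integral_cmult) measurable
  also have "\<dots> \<le> suminf (\<lambda>k. ennreal ((1/2) ^ k))"
  proof (intro suminf_le allI)
    fix k
    have "ennreal (2 ^ k) * (\<integral>\<^sup>+x\<in>A. f k x \<partial>M) \<le> ennreal (2 ^ k) * ennreal ((1/4) ^ k)"
      by (intro mult_left_mono C) simp
    also have "\<dots> = ennreal (2 ^ k * (1/4) ^ k)"
      by (simp add: ennreal_mult)
    also have "2 ^ k * (1/4) ^ k = (1/2 :: real) ^ k"
      by (simp flip: power_mult_distrib)
    finally show "ennreal (2 ^ k) * (\<integral>\<^sup>+x\<in>A. f k x \<partial>M) \<le> ennreal ((1/2) ^ k)" .
  qed auto
  also have "\<dots> = ennreal (suminf (\<lambda>k. (1/2) ^ k))"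
    by (intro suminf_ennreal2 summable_geometric) auto
  also have "\<dots> < \<infinity>"
    by simp
  finally have "\<exists>x\<in>A. ?h x < \<infinity>"
    using meas by (intro ex_finite_value[OF _ A]) (auto simp: eq)
  then obtain x where x: "x \<in> A" "?h x < \<infinity>"
    by blast
  have "ennreal (2 ^ k) * f k x \<le> ?h x" for k
    using sum_le_suminf[of "\<lambda>k. ennreal (2 ^ k) * (f k x * indicator A x)" "{k}"] x(1) by auto
  then show ?thesis
    using x by blast
qed

text \<open>\<open>Q\<close> is abstract so that one extraction serves Cauchy-type conditions in two
  indices as well as convergence to 0, where \<open>Q\<close> ignores its first index.\<close>

lemma ex_subseq_Suc_geometric:
  fixes Q :: "nat \<Rightarrow> nat \<Rightarrow> real \<Rightarrow> bool"
  assumes "\<And>e. e > 0 \<Longrightarrow> \<exists>N. \<forall>m\<ge>N. \<forall>n\<ge>N. Q m n e"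
  shows "\<exists>r. strict_mono (r :: nat \<Rightarrow> nat) \<and> (\<forall>k. Q (r (Suc k)) (r k) ((1/4) ^ k))"
proof -
  obtain N where N: "\<And>k m n. m \<ge> N k \<Longrightarrow> n \<ge> N k \<Longrightarrow> Q m n ((1/4) ^ k)"
    using assms[of "(1/4) ^ k" for k] by (metis zero_less_divide_1_iff zero_less_numeral zero_less_power)
  \<comment> \<open>The sum puts \<open>r k\<close> above \<open>N k\<close>, and the added
    \<open>k\<close> makes \<open>r\<close> strictly increasing even where \<open>N\<close>
    vanishes.\<close>
  define r where "r k = (\<Sum>i\<le>k. N i) + k" for k
  have "strict_mono r"
    by (auto simp: r_def strict_mono_Suc_iff)
  moreover have "N k \<le> r k" for k
    by (auto simp: r_def member_le_sum intro: trans_le_add1)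
  moreover have "N k \<le> r (Suc k)" for k
    using \<open>strict_mono r\<close> \<open>N k \<le> r k\<close> by (meson lessI less_imp_le order_trans strict_mono_less)
  ultimately show ?thesis
    using N by blast
qed

text \<open>The square roots of the bounds form a geometric series of ratio
  \<open>sqrt (1/2)\<close>, whose partial sums \<open>S\<close> control the distances between the
  terms of \<open>y\<close>.\<close>

lemma convergent_of_geometric_steps:
  fixes y :: "nat \<Rightarrow> 'h::{real_normed_vector, complete_space}"
  assumes "\<And>k. (norm (y (Suc k) - y k))\<^sup>2 \<le> B * (1/2) ^ k"
  shows "convergent y"
proof -
  define a where "a k = sqrt B * sqrt (1/2) ^ k" for k
  define S where "S n = (\<Sum>k<n. a k)" for n
  have step: "dist (y k) (y (Suc k)) \<le> a k" for k
  proof -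
    have "norm (y (Suc k) - y k) \<le> sqrt (B * (1/2) ^ k)"
      using assms by (rule real_le_rsqrt)
    then show ?thesis
      by (simp add: a_def real_sqrt_mult real_sqrt_power dist_norm norm_minus_commute)
  qed
  have le: "dist (y m) (y (m + d)) \<le> S (m + d) - S m" for m d
  proof (induction d)
    case (Suc d)
    have "dist (y m) (y (m + Suc d)) \<le> dist (y m) (y (m + d)) + dist (y (m + d)) (y (m + Suc d))"
      by (rule dist_triangle)
    then show ?case
      using Suc step[of "m + d"] by (simp add: S_def)
  qed simp
  have "sqrt (1/2) < 1"
    by (simp add: real_sqrt_divide)
  then have "summable a"
    unfolding a_def by (intro summable_mult summable_geometric) auto
  then have "Cauchy S"
    unfolding S_def by (metis LIMSEQ_imp_Cauchy summable_LIMSEQ)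
  have "Cauchy y"
  proof (rule metric_CauchyI)
    fix e :: real assume "e > 0"
    then obtain N where N: "\<And>m n. m \<ge> N \<Longrightarrow> n \<ge> N \<Longrightarrow> dist (S m) (S n) < e"
      using \<open>Cauchy S\<close> unfolding Cauchy_def by blast
    have *: "dist (y m) (y n) < e" if "m \<ge> N" "m \<le> n" for m n
    proof -
      have "dist (y m) (y n) \<le> dist (S m) (S n)"
        using le[of m "n - m"] that by (simp add: dist_real_def)
      then show ?thesis
        using N[of m n] that by simp
    qed
    have "dist (y m) (y n) < e" if "m \<ge> N" "n \<ge> N" for m n
      using *[of m n] *[of n m] that by (cases "m \<le> n") (auto simp: dist_commute)
    then show "\<exists>M. \<forall>m\<ge>M. \<forall>n\<ge>M. dist (y m) (y n) < e"
      by blast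
  qed
  then show ?thesis
    by (rule Cauchy_convergent)
qed

subsection \<open>Weighted energy of a curve\<close>

text \<open>The value lies in \<open>ennreal\<close>, so that monotonicity in \<open>A\<close> and
  Fatou's lemma apply without integrability conditions, and finiteness is a separate
  assertion.\<close>

definition energy :: "real \<Rightarrow> real set \<Rightarrow> (real \<Rightarrow> 'h::real_normed_vector) \<Rightarrow> ennreal" where
  "energy \<nu> A w = (\<integral>\<^sup>+s\<in>A. ennreal (exp (2 * \<nu> * s) * (norm (w s))\<^sup>2) \<partial>lborel)"

lemma energy_integrand_measurable:
  assumes "continuous_on A w" "A \<in> sets borel"
  shows "(\<lambda>s. ennreal (exp (2 * \<nu> * s) * (norm (w s))\<^sup>2) * indicator A s) \<in> borel_measurable lborel"
proof -
  have "(\<lambda>s. indicator A s *\<^sub>R (exp (2 * \<nu> * s) * (norm (w s))\<^sup>2)) \<in> borel_measurable borel"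
    using assms by (intro borel_measurable_continuous_on_indicator continuous_intros)
  then have "(\<lambda>s. ennreal (indicator A s *\<^sub>R (exp (2 * \<nu> * s) * (norm (w s))\<^sup>2))) \<in> borel_measurable borel"
    by simp
  also have "(\<lambda>s. ennreal (indicator A s *\<^sub>R (exp (2 * \<nu> * s) * (norm (w s))\<^sup>2)))
      = (\<lambda>s. ennreal (exp (2 * \<nu> * s) * (norm (w s))\<^sup>2) * indicator A s)"
    by (auto simp: indicator_def)
  finally show ?thesis
    by simp
qed

lemma energy_mono: "A \<subseteq> B \<Longrightarrow> energy \<nu> A w \<le> energy \<nu> B w"
  unfolding energy_def by (intro nn_integral_mono) (auto simp: indicator_def)

text \<open>This is the bridge to the real-valued integral of the squeezing inequality; continuity
  on a compact interval supplies integrability.\<close>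

lemma energy_eq_integral:
  assumes "continuous_on {l..r} w"
  shows "energy \<nu> {l..r} w = ennreal (LBINT s:{l..r}. exp (2 * \<nu> * s) * (norm (w s))\<^sup>2)"
proof -
  have "set_integrable lborel {l..r} (\<lambda>s. exp (2 * \<nu> * s) * (norm (w s))\<^sup>2)"
    using assms by (intro borel_integrable_atLeastAtMost' continuous_intros)
  then have "(\<integral>\<^sup>+s. ennreal (indicator {l..r} s *\<^sub>R (exp (2 * \<nu> * s) * (norm (w s))\<^sup>2)) \<partial>lborel)
      = ennreal (LBINT s:{l..r}. exp (2 * \<nu> * s) * (norm (w s))\<^sup>2)"
    unfolding set_integrable_def set_lebesgue_integral_def by (intro nn_integral_eq_integral) auto
  moreover have "ennreal (indicator {l..r} s *\<^sub>R (exp (2 * \<nu> * s) * (norm (w s))\<^sup>2))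
      = ennreal (exp (2 * \<nu> * s) * (norm (w s))\<^sup>2) * indicator {l..r} s" for s
    by (simp add: indicator_def)
  ultimately show ?thesis
    unfolding energy_def by simp
qed

text \<open>This is Fatou's lemma with moving domains: curves controlled on
  \<open>{- real k..0}\<close> pass their bound to a limit on \<open>{..0}\<close>. Each point has
  to lie in \<open>A k\<close> only eventually.\<close>

lemma energy_fatou:
  assumes w: "\<And>k. continuous_on (A k) (w k)" and A: "\<And>k. A k \<in> sets borel"
    and ev: "\<And>s. s \<in> B \<Longrightarrow> \<forall>\<^sub>F k in sequentially. s \<in> A k"
    and lim: "\<And>s. s \<in> B \<Longrightarrow> (\<lambda>k. w k s) \<longlonglongrightarrow> v s"
    and C: "\<And>k. energy \<nu> (A k) (w k) \<le> C"
  shows "energy \<nu> B v \<le> C"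
proof -
  let ?g = "\<lambda>k s. ennreal (exp (2 * \<nu> * s) * (norm (w k s))\<^sup>2) * indicator (A k) s"
  have "ennreal (exp (2 * \<nu> * s) * (norm (v s))\<^sup>2) * indicator B s \<le> liminf (\<lambda>k. ?g k s)" for s
  proof (cases "s \<in> B")
    case True
    have "(\<lambda>k. ennreal (exp (2 * \<nu> * s) * (norm (w k s))\<^sup>2))
        \<longlonglongrightarrow> ennreal (exp (2 * \<nu> * s) * (norm (v s))\<^sup>2)"
      by (intro tendsto_ennrealI tendsto_intros lim True)
    then have "(\<lambda>k. ?g k s) \<longlonglongrightarrow> ennreal (exp (2 * \<nu> * s) * (norm (v s))\<^sup>2)"
      by (rule Lim_transform_eventually) (use ev[OF True] in \<open>auto elim!: eventually_mono\<close>)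
    then show ?thesis
      using True by (simp add: lim_imp_Liminf)
  qed simp
  then have "energy \<nu> B v \<le> (\<integral>\<^sup>+s. liminf (\<lambda>k. ?g k s) \<partial>lborel)"
    unfolding energy_def by (rule nn_integral_mono)
  also have "\<dots> \<le> liminf (\<lambda>k. energy \<nu> (A k) (w k))"
    unfolding energy_def by (intro nn_integral_liminf energy_integrand_measurable w A)
  also have "\<dots> \<le> C"
    by (rule Liminf_le) (auto simp: C)
  finally show ?thesis .
qed

text \<open>The pointwise bound \<open>sq\<close> is integrated. It transfers finiteness of the
  energy between two trajectories and their difference.\<close>

lemma energy_add_le:
  assumes "continuous_on A v" "continuous_on A w" "A \<in> sets borel"
  shows "energy \<nu> A (\<lambda>s. v s + w s) \<le> 2 * energy \<nu> A v + 2 * energy \<nu> A w"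
proof -
  have sq: "(norm (x + y))\<^sup>2 \<le> 2 * (norm x)\<^sup>2 + 2 * (norm y)\<^sup>2" for x y :: 'a
  proof -
    have "(norm (x + y))\<^sup>2 \<le> (norm x + norm y)\<^sup>2"
      by (intro power_mono norm_triangle_ineq) auto
    also have "\<dots> \<le> 2 * (norm x)\<^sup>2 + 2 * (norm y)\<^sup>2"
      using sum_squares_bound[of "norm x" "norm y"] by (simp add: power2_sum)
    finally show ?thesis .
  qed
  let ?f = "\<lambda>u s. ennreal (exp (2 * \<nu> * s) * (norm (u s))\<^sup>2) * indicator A s"
  have "?f (\<lambda>s. v s + w s) s \<le> 2 * ?f v s + 2 * ?f w s" for s
  proof (cases "s \<in> A")
    case True
    have "exp (2 * \<nu> * s) * (norm (v s + w s))\<^sup>2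
        \<le> 2 * (exp (2 * \<nu> * s) * (norm (v s))\<^sup>2) + 2 * (exp (2 * \<nu> * s) * (norm (w s))\<^sup>2)"
      using mult_left_mono[OF sq[of "v s" "w s"], of "exp (2 * \<nu> * s)"] by (simp add: algebra_simps)
    then have "ennreal (exp (2 * \<nu> * s) * (norm (v s + w s))\<^sup>2)
        \<le> ennreal (2 * (exp (2 * \<nu> * s) * (norm (v s))\<^sup>2) + 2 * (exp (2 * \<nu> * s) * (norm (w s))\<^sup>2))"
      by (rule ennreal_leI)
    also have "\<dots> = 2 * ennreal (exp (2 * \<nu> * s) * (norm (v s))\<^sup>2) + 2 * ennreal (exp (2 * \<nu> * s) * (norm (w s))\<^sup>2)"
      by (simp add: ennreal_plus ennreal_mult)
    finally show ?thesis
      using True by simp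
  qed simp
  then have "energy \<nu> A (\<lambda>s. v s + w s) \<le> (\<integral>\<^sup>+s. 2 * ?f v s + 2 * ?f w s \<partial>lborel)"
    unfolding energy_def by (rule nn_integral_mono)
  also have "\<dots> = 2 * energy \<nu> A v + 2 * energy \<nu> A w"
    unfolding energy_def using energy_integrand_measurable[OF assms(1,3)] energy_integrand_measurable[OF assms(2,3)]
    by (simp add: nn_integral_add nn_integral_cmult)
  finally show ?thesis .
qed

text \<open>At the common time \<open>s\<close> the exponential weight is a positive constant and
  can be divided out.\<close>

lemma energy_bounded_subseq:
  fixes w :: "nat \<Rightarrow> real \<Rightarrow> 'h::real_normed_vector"
  assumes ab: "a < b" and w: "\<And>k. continuous_on {a..b} (w k)"
    and C: "\<And>k. energy \<nu> {a..b} (w k) \<le> C" "C < \<infinity>"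
  shows "\<exists>s\<in>{a..b}. \<exists>r. strict_mono (r :: nat \<Rightarrow> nat) \<and> bounded (range (\<lambda>k. w (r k) s))"
proof -
  have "\<exists>s\<in>{a..b}. \<exists>B<\<infinity>. \<exists>r. strict_mono (r :: nat \<Rightarrow> nat) \<and>
      (\<forall>k. ennreal (exp (2 * \<nu> * s) * (norm (w (r k) s))\<^sup>2) \<le> B)"
    using C ab unfolding energy_def
    by (intro bounded_integrals_pointwise_bounded_subseq[where C = C and M = lborel] energy_integrand_measurable w) auto
  then obtain s B and r :: "nat \<Rightarrow> nat" where s: "s \<in> {a..b}" "B < \<infinity>" "strict_mono r"
    and B: "\<And>k. ennreal (exp (2 * \<nu> * s) * (norm (w (r k) s))\<^sup>2) \<le> B"
    by blast
  obtain B' where B': "B = ennreal B'" "B' \<ge> 0"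
    using s(2) by (metis ennreal_cases infinity_ennreal_def less_irrefl)
  have "norm (w (r k) s) \<le> sqrt (B' / exp (2 * \<nu> * s))" for k
    using B[of k] B' by (intro real_le_rsqrt) (simp add: field_simps)
  then have "bounded (range (\<lambda>k. w (r k) s))"
    by (intro boundedI) auto
  then show ?thesis
    using s by blast
qed

lemma energy_geometric_decay:
  fixes w :: "nat \<Rightarrow> real \<Rightarrow> 'h::real_normed_vector"
  assumes ab: "a < b" and w: "\<And>k. continuous_on {a..b} (w k)"
    and C: "\<And>k. energy \<nu> {a..b} (w k) \<le> ennreal ((1/4) ^ k)"
  shows "\<exists>s\<in>{a..b}. \<exists>B. \<forall>k. (norm (w k s))\<^sup>2 \<le> B * (1/2) ^ k"
proof -
  have "\<exists>s\<in>{a..b}. \<exists>B<\<infinity>. \<forall>k. ennreal (2 ^ k) * ennreal (exp (2 * \<nu> * s) * (norm (w k s))\<^sup>2) \<le> B"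
    using C ab unfolding energy_def
    by (intro geometric_integrals_pointwise_geometric[where M = lborel] energy_integrand_measurable w) auto
  then obtain s B where s: "s \<in> {a..b}" "B < \<infinity>"
    and B: "\<And>k. ennreal (2 ^ k) * ennreal (exp (2 * \<nu> * s) * (norm (w k s))\<^sup>2) \<le> B"
    by blast
  obtain B' where B': "B = ennreal B'" "B' \<ge> 0"
    using s(2) by (metis ennreal_cases infinity_ennreal_def less_irrefl)
  have "(norm (w k s))\<^sup>2 \<le> B' / exp (2 * \<nu> * s) * (1/2) ^ k" for k
  proof -
    have "ennreal (2 ^ k * (exp (2 * \<nu> * s) * (norm (w k s))\<^sup>2)) \<le> ennreal B'"
      using B[of k] B' by (simp add: ennreal_mult)
    then have "2 ^ k * (exp (2 * \<nu> * s) * (norm (w k s))\<^sup>2) \<le> B'"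
      using B' by simp
    then show ?thesis
      by (simp add: field_simps power_divide)
  qed
  then show ?thesis
    using s by blast
qed

lemma compact_map_convergent_subseq:
  assumes f: "compact_map f" and y: "bounded (range y)"
  shows "\<exists>r l. strict_mono (r :: nat \<Rightarrow> nat) \<and> (\<lambda>k. f (y (r k))) \<longlonglongrightarrow> l"
proof -
  have "compact (closure (f ` range y))"
    using f y by (simp add: compact_map_def)
  moreover have "\<forall>k. f (y k) \<in> closure (f ` range y)"
    by (auto intro: subsetD[OF closure_subset])
  ultimately show ?thesis
    unfolding compact_def by (fastforce simp: o_def)
qed

subsection \<open>Cocycles with the squeezing property\<close>

locale squeezing_cocycle =
  fixes \<psi> :: "real \<Rightarrow> 'q::metric_space \<Rightarrow> 'h::{real_inner, complete_space} \<Rightarrow> 'h"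
    and \<theta> :: "real \<Rightarrow> 'q \<Rightarrow> 'q"
    and P :: "'h \<Rightarrow> 'h"
    and Hp Hm :: "'h set"
    and \<delta> \<nu> :: real
  assumes cocycle: "cocycle \<psi> \<theta>"
    and P_bounded: "bounded_linear P"
    and decomp: "orthogonal_direct_sum Hp Hm"
    and P_Hp: "P ` Hp \<subseteq> Hp" and P_Hm: "P ` Hm \<subseteq> Hm"
    and P_neg: "negative_on P Hm" and P_pos: "positive_on P Hp"
    and dim_Hm: "dim Hm > 0"
    and \<delta>_pos: "\<delta> > 0"
    and squeezing: "\<And>u v q l r. 0 \<le> l \<Longrightarrow> l \<le> r \<Longrightarrow>
           exp (2 * \<nu> * r) * quad_form P (\<psi> r q u - \<psi> r q v)
             - exp (2 * \<nu> * l) * quad_form P (\<psi> l q u - \<psi> l q v)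
           \<le> - \<delta> * (LBINT s:{l..r}. exp (2 * \<nu> * s) * (norm (\<psi> s q u - \<psi> s q v))\<^sup>2)"
begin

section \<open>The orthogonal projector and the quadratic form\<close>

abbreviation V :: "'h \<Rightarrow> real" where "V \<equiv> quad_form P"
abbreviation proj :: "'h \<Rightarrow> 'h" where "proj \<equiv> orthogonal_projector Hm"

lemma subspace_Hm: "subspace Hm"
  using decomp by (simp add: orthogonal_direct_sum_def)

lemma proj_split: "proj u \<in> Hm" "u - proj u \<in> Hp"
proof -
  obtain x y where xy: "x \<in> Hp" "y \<in> Hm" "u = x + y"
    using decomp unfolding orthogonal_direct_sum_def by blast
  then have "proj u = y"
    using orthogonal_projector_sum[OF decomp] by blast
  then show "proj u \<in> Hm" "u - proj u \<in> Hp"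
    using xy by auto
qed

lemma proj_orthogonal: "x \<in> Hp \<Longrightarrow> y \<in> Hm \<Longrightarrow> x \<bullet> y = 0"
  using decomp by (simp add: orthogonal_direct_sum_def orthogonal_def)

text \<open>The differences of the two components give a decomposition of \<open>u - v\<close>, and
  decompositions are unique.\<close>

lemma proj_diff: "proj (u - v) = proj u - proj v"
proof -
  have "(u - proj u) - (v - proj v) \<in> Hp" "proj u - proj v \<in> Hm"
    using proj_split decomp by (auto simp: orthogonal_direct_sum_def intro: subspace_diff)
  from orthogonal_projector_sum[OF decomp this] show ?thesis
    by simp
qed

lemma norm_proj_le: "norm (proj u) \<le> norm u"
proof -
  have "u \<bullet> proj u = proj u \<bullet> proj u"
    using proj_orthogonal[OF proj_split(2) proj_split(1), of u u] by (simp add: inner_diff_left)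
  then have "(norm (proj u))\<^sup>2 \<le> norm u * norm (proj u)"
    using norm_cauchy_schwarz[of u "proj u"] by (simp add: power2_norm_eq_inner)
  then show ?thesis
    by (cases "proj u = 0") (auto simp: power2_eq_square)
qed

lemma proj_tendsto:
  assumes "(f \<longlongrightarrow> l) F"
  shows "((\<lambda>x. proj (f x)) \<longlongrightarrow> proj l) F"
proof -
  have "((\<lambda>x. norm (f x - l)) \<longlongrightarrow> 0) F"
    using assms by (simp add: tendsto_norm_zero LIM_zero)
  then have "((\<lambda>x. proj (f x) - proj l) \<longlongrightarrow> 0) F"
    by (rule Lim_null_comparison[rotated]) (simp add: norm_proj_le flip: proj_diff)
  then show ?thesis
    by (rule LIM_zero_cancel)
qed

lemma proj_continuous: "continuous_on A proj"
  unfolding continuous_on_def by (intro ballI proj_tendsto tendsto_ident_at)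

lemma quad_form_abs_le: "\<bar>V u\<bar> \<le> onorm P * (norm u)\<^sup>2"
proof -
  have "\<bar>V u\<bar> \<le> norm (P u) * norm u"
    unfolding quad_form_def by (rule Cauchy_Schwarz_ineq2)
  also have "\<dots> \<le> onorm P * norm u * norm u"
    by (intro mult_right_mono onorm P_bounded) simp
  finally show ?thesis
    by (simp add: power2_eq_square)
qed

lemma onorm_P_nonneg: "onorm P \<ge> 0"
  by (rule onorm_pos_le[OF P_bounded])

text \<open>Invariance of both summands under \<open>P\<close> removes the cross terms, so
  \<open>V u = V x + V y\<close>. Here \<open>V x\<close> is nonnegative, and only the component
  \<open>y\<close> in \<open>Hm\<close> can contribute a negative amount.\<close>

lemma quad_form_lower: "- (onorm P * (norm (proj u))\<^sup>2) \<le> V u"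
proof -
  interpret P: bounded_linear P by (rule P_bounded)
  define x y where "x = u - proj u" and "y = proj u"
  have xy: "x \<in> Hp" "y \<in> Hm" "u = x + y"
    using proj_split by (auto simp: x_def y_def)
  have "P x \<in> Hp" "P y \<in> Hm"
    using xy P_Hp P_Hm by auto
  then have "P x \<bullet> y = 0" "P y \<bullet> x = 0"
    using xy proj_orthogonal[of "P x" y] proj_orthogonal[of x "P y"] by (auto simp: inner_commute)
  then have "V u = V x + V y"
    by (simp add: quad_form_def xy(3) P.add inner_add_left inner_add_right)
  moreover have "V x \<ge> 0"
    using P_pos xy(1) by (cases "x = 0") (auto simp: positive_on_def quad_form_def less_imp_le)
  moreover have "- (onorm P * (norm y)\<^sup>2) \<le> V y"
    using quad_form_abs_le[of y] by linarith
  ultimately show ?thesis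
    by (simp add: y_def)
qed

lemma quad_form_nonneg: "proj u = 0 \<Longrightarrow> V u \<ge> 0"
  using quad_form_lower[of u] by simp

lemma quad_form_nonpos: "u \<in> Hm \<Longrightarrow> V u \<le> 0"
  using P_neg by (cases "u = 0") (auto simp: negative_on_def quad_form_def less_imp_le)

section \<open>The cocycle and trajectories on half-lines\<close>

lemma flow_add: "\<theta> (t + s) q = \<theta> t (\<theta> s q)"
  using cocycle by (simp add: cocycle_def flow_def)

lemma cocycle_zero: "\<psi> 0 q u = u"
  using cocycle by (simp add: cocycle_def)

lemma cocycle_add: "t \<ge> 0 \<Longrightarrow> s \<ge> 0 \<Longrightarrow> \<psi> (t + s) q u = \<psi> t (\<theta> s q) (\<psi> s q u)"
  using cocycle by (simp add: cocycle_def)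

lemma cocycle_continuous_time: "continuous_on {0..} (\<lambda>t. \<psi> t q u)"
proof -
  have "continuous_on ({0..} \<times> UNIV \<times> UNIV) (\<lambda>(t, q, u). \<psi> t q u)"
    using cocycle by (simp add: cocycle_def)
  then have "continuous_on {0..} ((\<lambda>(t, q, u). \<psi> t q u) \<circ> (\<lambda>t. (t, q, u)))"
    by (intro continuous_on_compose continuous_intros) (auto elim: continuous_on_subset)
  then show ?thesis
    by (simp add: o_def)
qed

lemma cocycle_continuous_space:
  assumes "t \<ge> 0"
  shows "continuous_on UNIV (\<psi> t q)"
proof -
  have "continuous_on ({0..} \<times> UNIV \<times> UNIV) (\<lambda>(t, q, u). \<psi> t q u)"
    using cocycle by (simp add: cocycle_def)
  then have "continuous_on UNIV ((\<lambda>(t, q, u). \<psi> t q u) \<circ> (\<lambda>u. (t, q, u)))"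
    using assms by (intro continuous_on_compose continuous_intros) (auto elim: continuous_on_subset)
  then show ?thesis
    by (simp add: o_def)
qed

lemma cocycle_tendsto:
  assumes "t \<ge> 0" "f \<longlonglongrightarrow> l"
  shows "(\<lambda>k. \<psi> t q (f k)) \<longlonglongrightarrow> \<psi> t q l"
  using continuous_on_tendsto_compose[OF cocycle_continuous_space[OF assms(1)] assms(2)] by simp

text \<open>Trajectories started at a finite time \<open>a\<close> and restrictions of complete
  trajectories are both of this kind, so the estimates below cover them together. Values before
  \<open>a\<close> are unconstrained.\<close>

definition half_trajectory :: "'q \<Rightarrow> real \<Rightarrow> (real \<Rightarrow> 'h) \<Rightarrow> bool" where
  "half_trajectory q a x \<longleftrightarrow>
     continuous_on {a..} x \<and> (\<forall>t\<ge>0. \<forall>s\<ge>a. x (t + s) = \<psi> t (\<theta> s q) (x s))"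

lemma half_trajectory_cocycle: "half_trajectory q a (\<lambda>s. \<psi> (s - a) (\<theta> a q) z)"
  unfolding half_trajectory_def
proof (intro conjI allI impI)
  have "continuous_on {a..} ((\<lambda>t. \<psi> t (\<theta> a q) z) \<circ> (\<lambda>s. s - a))"
    by (intro continuous_on_compose continuous_intros continuous_on_subset[OF cocycle_continuous_time]) auto
  then show "continuous_on {a..} (\<lambda>s. \<psi> (s - a) (\<theta> a q) z)"
    by (simp add: o_def)
next
  fix t s :: real assume "t \<ge> 0" "s \<ge> a"
  then show "\<psi> (t + s - a) (\<theta> a q) z = \<psi> t (\<theta> s q) (\<psi> (s - a) (\<theta> a q) z)"
    using cocycle_add[of t "s - a" "\<theta> a q" z] flow_add[of "s - a" a q] by (simp add: add_diff_eq)
qed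

lemma half_trajectory_mono: "half_trajectory q a x \<Longrightarrow> a \<le> b \<Longrightarrow> half_trajectory q b x"
  by (auto simp: half_trajectory_def elim: continuous_on_subset)

lemma complete_imp_half_trajectory: "complete_trajectory \<psi> \<theta> q x \<Longrightarrow> half_trajectory q a x"
  by (auto simp: half_trajectory_def complete_trajectory_def elim: continuous_on_subset)

lemma half_trajectory_continuous: "half_trajectory q a x \<Longrightarrow> A \<subseteq> {a..} \<Longrightarrow> continuous_on A x"
  by (auto simp: half_trajectory_def elim: continuous_on_subset)

lemma half_trajectory_step: "half_trajectory q a x \<Longrightarrow> a \<le> s \<Longrightarrow> s \<le> t \<Longrightarrow> x t = \<psi> (t - s) (\<theta> s q) (x s)"
  unfolding half_trajectory_def by (metis diff_add_cancel diff_ge_0_iff_ge)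

text \<open>Convergence at one time propagates forward, because the cocycle is continuous in the
  state.\<close>

lemma half_trajectory_tendsto:
  assumes "\<And>k. half_trajectory q a (x k)" "half_trajectory q a y" "a \<le> s" "s \<le> t"
    and "(\<lambda>k. x k s) \<longlonglongrightarrow> y s"
  shows "(\<lambda>k. x k t) \<longlonglongrightarrow> y t"
  using cocycle_tendsto[OF _ assms(5), of "t - s" "\<theta> s q"] assms(3,4)
    half_trajectory_step[OF assms(1,3,4)] half_trajectory_step[OF assms(2,3,4)] by simp

section \<open>The squeezing inequality along trajectories\<close>

text \<open>The hypothesis is applied over the base point \<open>\<theta> l q\<close> on
  \<open>{0..r-l}\<close>. Multiplying by \<open>exp (2 * \<nu> * l)\<close> and translating the
  integration variable gives the inequality in the original time.\<close>

lemma squeezing_half_trajectories: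
  assumes x: "half_trajectory q a x" and y: "half_trajectory q a y" and "a \<le> l" "l \<le> r"
  shows "exp (2 * \<nu> * r) * V (x r - y r) + \<delta> * (LBINT s:{l..r}. exp (2 * \<nu> * s) * (norm (x s - y s))\<^sup>2)
    \<le> exp (2 * \<nu> * l) * V (x l - y l)"
proof -
  let ?f = "\<lambda>s. exp (2 * \<nu> * s) * (norm (x s - y s))\<^sup>2"
  define J where "J = (LBINT s:{0..r-l}. exp (2 * \<nu> * s) * (norm (x (l + s) - y (l + s)))\<^sup>2)"
  have step: "\<psi> t (\<theta> l q) (x l) - \<psi> t (\<theta> l q) (y l) = x (l + t) - y (l + t)" if "t \<ge> 0" for t
    using half_trajectory_step[OF x \<open>a \<le> l\<close>, of "l + t"] half_trajectory_step[OF y \<open>a \<le> l\<close>, of "l + t"] that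
    by simp
  have "exp (2 * \<nu> * (r - l)) * V (x r - y r) - V (x l - y l)
      \<le> - \<delta> * (LBINT s:{0..r-l}. exp (2 * \<nu> * s) * (norm (\<psi> s (\<theta> l q) (x l) - \<psi> s (\<theta> l q) (y l)))\<^sup>2)"
    using squeezing[of 0 "r - l" "\<theta> l q" "x l" "y l"] \<open>l \<le> r\<close> step[of "r - l"] by (simp add: cocycle_zero)
  also have "(LBINT s:{0..r-l}. exp (2 * \<nu> * s) * (norm (\<psi> s (\<theta> l q) (x l) - \<psi> s (\<theta> l q) (y l)))\<^sup>2)
      = J"
    unfolding J_def by (intro set_lebesgue_integral_cong) (auto simp: step)
  finally have "exp (2 * \<nu> * (r - l)) * V (x r - y r)
      + \<delta> * J \<le> V (x l - y l)"
    by simp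
  then have "exp (2 * \<nu> * l) * (exp (2 * \<nu> * (r - l)) * V (x r - y r)
      + \<delta> * J)
      \<le> exp (2 * \<nu> * l) * V (x l - y l)"
    by (intro mult_left_mono) auto
  moreover have "exp (2 * \<nu> * l) * exp (2 * \<nu> * (r - l)) = exp (2 * \<nu> * r)"
    by (simp add: algebra_simps flip: exp_add)
  moreover have "exp (2 * \<nu> * l) * J
      = (LBINT s:{l..r}. ?f s)"
  proof -
    have "(LBINT s:{l..r}. ?f s) = (\<integral>s. indicator {l..r} (l + 1 * s) *\<^sub>R ?f (l + 1 * s) \<partial>lborel)"
      unfolding set_lebesgue_integral_def by (subst lborel_integral_real_affine[where c = 1 and t = l]) auto
    also have "\<dots> = (LBINT s:{0..r-l}. exp (2 * \<nu> * l) * (exp (2 * \<nu> * s) * (norm (x (l + s) - y (l + s)))\<^sup>2))"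
      unfolding set_lebesgue_integral_def
      by (intro Bochner_Integration.integral_cong) (auto simp: indicator_def algebra_simps exp_add)
    finally show ?thesis
      by (simp add: J_def)
  qed
  moreover have "exp (2 * \<nu> * l) * (exp (2 * \<nu> * (r - l)) * V (x r - y r) + \<delta> * J)
      = (exp (2 * \<nu> * l) * exp (2 * \<nu> * (r - l))) * V (x r - y r) + \<delta> * (exp (2 * \<nu> * l) * J)"
    by (simp add: distrib_left)
  ultimately show ?thesis
    by simp
qed

lemma energy_le_half_trajectories:
  assumes x: "half_trajectory q a x" and y: "half_trajectory q a y" and al: "a \<le> l" and lr: "l \<le> r"
  shows "ennreal \<delta> * energy \<nu> {l..r} (\<lambda>s. x s - y s)
    \<le> ennreal (exp (2 * \<nu> * l) * V (x l - y l) - exp (2 * \<nu> * r) * V (x r - y r))"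
proof -
  have "continuous_on {l..r} (\<lambda>s. x s - y s)"
    using al by (intro continuous_intros half_trajectory_continuous[OF x] half_trajectory_continuous[OF y]) auto
  then have "ennreal \<delta> * energy \<nu> {l..r} (\<lambda>s. x s - y s)
      = ennreal (\<delta> * (LBINT s:{l..r}. exp (2 * \<nu> * s) * (norm (x s - y s))\<^sup>2))"
    using \<delta>_pos by (simp add: energy_eq_integral ennreal_mult')
  also have "\<dots> \<le> ennreal (exp (2 * \<nu> * l) * V (x l - y l) - exp (2 * \<nu> * r) * V (x r - y r))"
    using squeezing_half_trajectories[OF assms] by (intro ennreal_leI) simp
  finally show ?thesis .
qed

text \<open>The integral in the squeezing inequality is nonnegative and is dropped. This
  monotonicity is what makes the steering map from the past expanding.\<close>

lemma quad_form_decreasing: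
  assumes x: "half_trajectory q a x" and y: "half_trajectory q a y" and "a \<le> l" "l \<le> r"
  shows "exp (2 * \<nu> * r) * V (x r - y r) \<le> exp (2 * \<nu> * l) * V (x l - y l)"
proof -
  have "0 \<le> (LBINT s:{l..r}. exp (2 * \<nu> * s) * (norm (x s - y s))\<^sup>2)"
    unfolding set_lebesgue_integral_def by (intro integral_nonneg_AE) auto
  then have "0 \<le> \<delta> * (LBINT s:{l..r}. exp (2 * \<nu> * s) * (norm (x s - y s))\<^sup>2)"
    using \<delta>_pos by (intro mult_nonneg_nonneg) auto
  then show ?thesis
    using squeezing_half_trajectories[OF assms] by linarith
qed

lemma energy_le_divide:
  assumes "ennreal \<delta> * e \<le> ennreal M" "M \<ge> 0"
  shows "e \<le> ennreal (M / \<delta>)"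
proof (cases e)
  case (real r)
  then have "\<delta> * r \<le> M"
    using assms \<delta>_pos by (simp add: ennreal_mult[symmetric])
  then show ?thesis
    using real \<delta>_pos by (auto simp: field_simps intro!: ennreal_leI)
next
  case top
  then show ?thesis
    using assms \<delta>_pos by (simp add: ennreal_mult_top top_unique)
qed

section \<open>Energy and closeness of amenable trajectories\<close>

text \<open>Continuity gives measurability, so integrability amounts to a finite nonnegative
  integral.\<close>

lemma amenable_trajectory_iff:
  "amenable_trajectory \<psi> \<theta> \<nu> q u \<longleftrightarrow> complete_trajectory \<psi> \<theta> q u \<and> energy \<nu> {..0} u < \<infinity>"
proof -
  have "set_integrable lborel {..0} (\<lambda>s. exp (2 * \<nu> * s) * (norm (u s))\<^sup>2) \<longleftrightarrow> energy \<nu> {..0} u < \<infinity>"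
    if "complete_trajectory \<psi> \<theta> q u"
  proof -
    have "continuous_on {..0} u"
      using that by (auto simp: complete_trajectory_def elim: continuous_on_subset)
    then have "(\<lambda>s. indicator {..0} s *\<^sub>R (exp (2 * \<nu> * s) * (norm (u s))\<^sup>2)) \<in> borel_measurable borel"
      by (intro borel_measurable_continuous_on_indicator continuous_intros) auto
    moreover have "(\<integral>\<^sup>+s. ennreal (norm (indicator {..0} s *\<^sub>R (exp (2 * \<nu> * s) * (norm (u s))\<^sup>2))) \<partial>lborel)
        = energy \<nu> {..0} u"
      unfolding energy_def by (intro nn_integral_cong) (auto simp: indicator_def)
    ultimately show ?thesis
      unfolding set_integrable_def integrable_iff_bounded by simp
  qed
  then show ?thesis
    unfolding amenable_trajectory_def by blast
qed

text \<open>Otherwise the integrand would stay at least \<open>e\<close> on an entire half-line. The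
  resulting times \<open>l\<close> make the boundary term at the left end of the squeezing
  inequality negligible.\<close>

lemma finite_energy_small_values:
  assumes fin: "energy \<nu> {..0} w < \<infinity>" and e: "e > 0"
  shows "\<exists>l\<le>N. l \<le> 0 \<and> exp (2 * \<nu> * l) * (norm (w l))\<^sup>2 < e"
proof (rule ccontr)
  assume neg: "\<not> ?thesis"
  obtain C where C: "energy \<nu> {..0} w = ennreal C" "C \<ge> 0"
    using fin by (metis ennreal_cases infinity_ennreal_def less_irrefl)
  \<comment> \<open>An interval of this length carries energy at least \<open>e * T = C + e\<close>,
    more than the total \<open>C\<close>.\<close>
  define T where "T = C / e + 1"
  have T: "T \<ge> 0" "e * T = C + e"
    using C(2) e by (auto simp: T_def distrib_left)
  have "(\<integral>\<^sup>+s. ennreal e * indicator {min N 0 - T..min N 0} s \<partial>lborel) \<le> energy \<nu> {..0} w"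
    unfolding energy_def
  proof (intro nn_integral_mono)
    fix s :: real
    show "ennreal e * indicator {min N 0 - T..min N 0} s
        \<le> ennreal (exp (2 * \<nu> * s) * (norm (w s))\<^sup>2) * indicator {..0} s"
      using neg by (cases "s \<in> {min N 0 - T..min N 0}") (auto simp: not_less intro!: ennreal_leI)
  qed
  moreover have "(\<integral>\<^sup>+s. ennreal e * indicator {min N 0 - T..min N 0} s \<partial>lborel) = ennreal (C + e)"
  proof -
    have "emeasure lborel {min N 0 - T..min N 0} = ennreal T"
      using T(1) by (subst emeasure_lborel_Icc) auto
    then have "(\<integral>\<^sup>+s. ennreal e * indicator {min N 0 - T..min N 0} s \<partial>lborel) = ennreal e * ennreal T"
      by (subst nn_integral_cmult_indicator) auto
    also have "\<dots> = ennreal (C + e)"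
      using e T by (metis ennreal_mult less_imp_le)
    finally show ?thesis .
  qed
  ultimately show False
    using C e by simp
qed

text \<open>Squeezing on \<open>{l..0}\<close> leaves a boundary term at \<open>l\<close>,
  negligible for suitable \<open>l\<close> in the far past, and \<open>- V (w 0)\<close>, which
  \<open>quad_form_lower\<close> bounds by the projection.\<close>

lemma energy_le_amenable:
  assumes u: "amenable_trajectory \<psi> \<theta> \<nu> q u" and v: "amenable_trajectory \<psi> \<theta> \<nu> q v"
  shows "energy \<nu> {..0} (\<lambda>s. u s - v s) \<le> ennreal (onorm P * (norm (proj (u 0 - v 0)))\<^sup>2 / \<delta>)"
proof -
  define w where "w = (\<lambda>s. u s - v s)"
  define M where "M = onorm P * (norm (proj (w 0)))\<^sup>2"
  have M: "M \<ge> 0" "- V (w 0) \<le> M"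
    using quad_form_lower[of "w 0"] onorm_P_nonneg by (auto simp: M_def)
  have cont: "continuous_on A u" "continuous_on A v" for A
    using u v by (auto simp: amenable_trajectory_def complete_trajectory_def elim: continuous_on_subset)
  have half: "half_trajectory q a u" "half_trajectory q a v" for a
    using u v by (auto simp: amenable_trajectory_def complete_imp_half_trajectory)
  \<comment> \<open>This crude bound only shows that the energy is finite, which provides the times
    \<open>l\<close> used below.\<close>
  have "energy \<nu> {..0} w \<le> 2 * energy \<nu> {..0} u + 2 * energy \<nu> {..0} (\<lambda>s. - v s)"
    unfolding w_def using energy_add_le[of "{..0}" u "\<lambda>s. - v s"] cont by (simp add: continuous_on_minus)
  also have "energy \<nu> {..0} (\<lambda>s. - v s) = energy \<nu> {..0} v"
    by (simp add: energy_def)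
  also have "2 * energy \<nu> {..0} u + 2 * energy \<nu> {..0} v < \<infinity>"
    using u v by (simp add: amenable_trajectory_iff ennreal_mult_less_top)
  finally have fin: "energy \<nu> {..0} w < \<infinity>" .
  have bound: "energy \<nu> {- real n..0} w \<le> ennreal (M / \<delta>)" for n
  proof -
    have le: "energy \<nu> {- real n..0} w \<le> ennreal (M / \<delta>) + ennreal e" if "e > 0" for e
    proof -
      \<comment> \<open>Chosen so that \<open>(onorm P + 1) * e' = \<delta> * e\<close>; the summand
        1 keeps the denominator positive when \<open>P\<close> is 0.\<close>
      define e' where "e' = \<delta> * e / (onorm P + 1)"
      have "e' > 0"
        using that \<delta>_pos onorm_P_nonneg by (simp add: e'_def)
      then obtain l where l: "l \<le> - real n" "l \<le> 0" "exp (2 * \<nu> * l) * (norm (w l))\<^sup>2 < e'"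
        using finite_energy_small_values[OF fin] by blast
      have "exp (2 * \<nu> * l) * V (w l) \<le> exp (2 * \<nu> * l) * (onorm P * (norm (w l))\<^sup>2)"
        using quad_form_abs_le[of "w l"] by (intro mult_left_mono) auto
      also have "\<dots> = onorm P * (exp (2 * \<nu> * l) * (norm (w l))\<^sup>2)"
        by simp
      also have "\<dots> \<le> onorm P * e'"
        using l(3) onorm_P_nonneg by (intro mult_left_mono) auto
      also have "\<dots> \<le> (onorm P + 1) * e'"
        using \<open>e' > 0\<close> by simp
      also have "\<dots> = \<delta> * e"
        using onorm_P_nonneg by (simp add: e'_def)
      finally have *: "exp (2 * \<nu> * l) * V (w l) \<le> \<delta> * e" .
      have "ennreal \<delta> * energy \<nu> {l..0} w \<le> ennreal (exp (2 * \<nu> * l) * V (w l) - V (w 0))"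
        using energy_le_half_trajectories[OF half(1) half(2) order_refl l(2)] by (simp add: w_def)
      also have "\<dots> \<le> ennreal (\<delta> * e + M)"
        using * M by (intro ennreal_leI) auto
      finally have "energy \<nu> {l..0} w \<le> ennreal ((\<delta> * e + M) / \<delta>)"
        using M that \<delta>_pos by (intro energy_le_divide) auto
      also have "(\<delta> * e + M) / \<delta> = M / \<delta> + e"
        using \<delta>_pos by (simp add: field_simps)
      finally have "energy \<nu> {l..0} w \<le> ennreal (M / \<delta>) + ennreal e"
        using M \<delta>_pos that by (simp add: ennreal_plus)
      moreover have "energy \<nu> {- real n..0} w \<le> energy \<nu> {l..0} w"
        using l by (intro energy_mono) auto
      ultimately show ?thesis
        by (rule order_trans[rotated])
    qed
    show ?thesis
      by (rule ennreal_le_epsilon) (use le in auto)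
  qed
  \<comment> \<open>Fatou with the constant sequence \<open>w\<close> on growing intervals passes to
    the half-line.\<close>
  have "energy \<nu> {..0} w \<le> ennreal (M / \<delta>)"
  proof (rule energy_fatou)
    show "continuous_on {- real n..0} w" for n
      unfolding w_def by (intro continuous_intros cont)
    show "\<forall>\<^sub>F n in sequentially. s \<in> {- real n..0}" if "s \<in> {..0}" for s
      using that eventually_ge_at_top[of "nat \<lceil>- s\<rceil>"] by (auto elim!: eventually_mono)
  qed (auto intro: bound)
  then show ?thesis
    by (simp add: w_def M_def)
qed

text \<open>A subsequence staying away from \<open>v 0\<close> would contain a further one whose
  energies decay geometrically. That one converges at some time in \<open>{-1..0}\<close>, hence at
  time 0, a contradiction. Constant sequences yield injectivity of the projector, general ones
  continuity of its inverse.\<close>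

lemma amenable_tendsto:
  assumes u: "\<And>k. amenable_trajectory \<psi> \<theta> \<nu> q (u k)" and v: "amenable_trajectory \<psi> \<theta> \<nu> q v"
    and lim: "(\<lambda>k. proj (u k 0)) \<longlonglongrightarrow> proj (v 0)"
  shows "(\<lambda>k. u k 0) \<longlonglongrightarrow> v 0"
proof (rule ccontr)
  assume "\<not> ?thesis"
  then obtain e where "e > 0" and e: "\<not> (\<forall>\<^sub>F k in sequentially. dist (u k 0) (v 0) < e)"
    unfolding tendsto_iff by blast
  then have "infinite {k. e \<le> dist (u k 0) (v 0)}"
    by (simp add: not_eventually frequently_cofinite cofinite_eq_sequentially[symmetric] not_less)
  then obtain r where r: "strict_mono (r :: nat \<Rightarrow> nat)" "\<And>k. e \<le> dist (u (r k) 0) (v 0)"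
    using infinite_enumerate by blast
  \<comment> \<open>\<open>f k\<close> is the bound that \<open>energy_le_amenable\<close> gives for
    the distance from \<open>u (r k)\<close> to \<open>v\<close>.\<close>
  define f where "f k = onorm P * (norm (proj (u (r k) 0 - v 0)))\<^sup>2 / \<delta>" for k
  have "(\<lambda>k. proj (u (r k) 0)) \<longlonglongrightarrow> proj (v 0)"
    using LIMSEQ_subseq_LIMSEQ[OF lim r(1)] by (simp add: o_def)
  then have "f \<longlonglongrightarrow> onorm P * (norm (proj (v 0) - proj (v 0)))\<^sup>2 / \<delta>"
    unfolding f_def proj_diff using \<delta>_pos by (intro tendsto_intros) auto
  then have f0: "f \<longlonglongrightarrow> 0"
    by simp
  have "\<exists>N. \<forall>m\<ge>N. \<forall>n\<ge>N. f n < e" if "e > 0" for e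
    using order_tendstoD(2)[OF f0 that] by (auto simp: eventually_sequentially)
  then obtain r' where r': "strict_mono (r' :: nat \<Rightarrow> nat)" "\<And>k. f (r' k) < (1/4) ^ k"
    using ex_subseq_Suc_geometric[of "\<lambda>m n e. f n < e"] by blast
  define x where "x k = u (r (r' k))" for k
  have half: "half_trajectory q (-1) (x k)" "half_trajectory q (-1) v" for k
    using u v by (auto simp: x_def amenable_trajectory_def complete_imp_half_trajectory)
  have "\<exists>s\<in>{-1..0}. \<exists>B. \<forall>k. (norm (x k s - v s))\<^sup>2 \<le> B * (1/2) ^ k"
  proof (rule energy_geometric_decay)
    show "continuous_on {-1..0} (\<lambda>s. x k s - v s)" for k
      by (intro continuous_intros half_trajectory_continuous[OF half(1)] half_trajectory_continuous[OF half(2)]) auto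
    fix k
    have "energy \<nu> {-1..0} (\<lambda>s. x k s - v s) \<le> energy \<nu> {..0} (\<lambda>s. x k s - v s)"
      by (intro energy_mono) auto
    also have "\<dots> \<le> ennreal (f (r' k))"
      unfolding f_def x_def by (rule energy_le_amenable[OF u v])
    also have "\<dots> \<le> ennreal ((1/4) ^ k)"
      using r'(2)[of k] by (intro ennreal_leI) simp
    finally show "energy \<nu> {-1..0} (\<lambda>s. x k s - v s) \<le> ennreal ((1/4) ^ k)" .
  qed simp
  then obtain s B where s: "s \<in> {-1..0}" and B: "\<And>k. (norm (x k s - v s))\<^sup>2 \<le> B * (1/2) ^ k"
    by blast
  have "(\<lambda>k. B * (1/2) ^ k) \<longlonglongrightarrow> 0"
    by (rule tendsto_mult_right_zero, rule LIMSEQ_power_zero) simp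
  then have "(\<lambda>k. (norm (x k s - v s))\<^sup>2) \<longlonglongrightarrow> 0"
    by (rule Lim_null_comparison[rotated]) (simp add: B)
  then have "(\<lambda>k. x k s - v s) \<longlonglongrightarrow> 0"
    by (simp add: tendsto_norm_zero_iff)
  then have "(\<lambda>k. x k s) \<longlonglongrightarrow> v s"
    by (rule LIM_zero_cancel)
  then have "(\<lambda>k. x k 0) \<longlonglongrightarrow> v 0"
    using s by (intro half_trajectory_tendsto[OF half(1) half(2), of s 0]) simp_all
  then have "\<forall>\<^sub>F k in sequentially. dist (x k 0) (v 0) < e"
    using \<open>e > 0\<close> by (rule tendstoD)
  then obtain k where "dist (x k 0) (v 0) < e"
    by (auto simp: eventually_sequentially)
  then show False
    using r(2)[of "r' k"] by (simp add: x_def)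
qed

subsection \<open>Surjectivity of the projector\<close>

text \<open>The starting point \<open>z + \<eta>\<close> varies over an affine copy of
  \<open>Hm\<close>. Projecting the state at time 0 gives a continuous expanding self-map
  \<open>F\<close> of \<open>Hm\<close>, which is therefore onto.\<close>

lemma steer_from_past:
  assumes a: "a \<le> 0" and \<zeta>: "\<zeta> \<in> Hm"
  shows "\<exists>x. half_trajectory q a x \<and> x a - z \<in> Hm \<and> proj (x 0) = \<zeta>"
proof -
  define x where "x \<eta> s = \<psi> (s - a) (\<theta> a q) (z + \<eta>)" for \<eta> s
  define F where "F \<eta> = proj (x \<eta> 0)" for \<eta>
  have half: "half_trajectory q a (x \<eta>)" for \<eta>
    unfolding x_def by (rule half_trajectory_cocycle)
  have start: "x \<eta> a = z + \<eta>" for \<eta>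
    by (simp add: x_def cocycle_zero)
  obtain c where c: "c > 0" "\<And>\<eta>. \<eta> \<in> Hm \<Longrightarrow> c * (norm \<eta>)\<^sup>2 \<le> - V \<eta>"
    using negative_on_finite_dim_coercive[OF subspace_Hm dim_Hm P_bounded P_neg] by blast
  \<comment> \<open>The constant comes from chaining coercivity of \<open>- V\<close> on
    \<open>Hm\<close> at time \<open>a\<close>, monotonicity up to time 0, and
    \<open>quad_form_lower\<close> there. It may depend on \<open>a\<close>, since only surjectivity
    of \<open>F\<close> is extracted.\<close>
  define c' where "c' = sqrt (exp (2 * \<nu> * a) * c / (onorm P + 1))"
  have "F ` Hm = Hm"
  proof (rule expanding_self_map_surjective[OF subspace_Hm dim_Hm])
    have "continuous_on Hm (\<lambda>\<eta>. \<psi> (0 - a) (\<theta> a q) (z + \<eta>))"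
      using a by (intro continuous_on_compose2[OF cocycle_continuous_space] continuous_intros) auto
    then show "continuous_on Hm F"
      unfolding F_def x_def by (rule continuous_on_compose2[OF proj_continuous]) auto
    show "F ` Hm \<subseteq> Hm"
      using proj_split by (auto simp: F_def)
    show "c' > 0"
      using c onorm_P_nonneg by (simp add: c'_def)
    fix \<eta> \<xi> assume "\<eta> \<in> Hm" "\<xi> \<in> Hm"
    then have "\<eta> - \<xi> \<in> Hm"
      by (rule subspace_diff[OF subspace_Hm])
    have "exp (2 * \<nu> * a) * (c * (norm (\<eta> - \<xi>))\<^sup>2) \<le> exp (2 * \<nu> * a) * - V (\<eta> - \<xi>)"
      using c(2)[OF \<open>\<eta> - \<xi> \<in> Hm\<close>] by (intro mult_left_mono) auto
    also have "\<dots> \<le> - V (x \<eta> 0 - x \<xi> 0)"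
      using quad_form_decreasing[OF half half order_refl a, of \<eta> \<xi>] by (simp add: start)
    also have "\<dots> \<le> onorm P * (norm (F \<eta> - F \<xi>))\<^sup>2"
      using quad_form_lower[of "x \<eta> 0 - x \<xi> 0"] by (simp add: F_def proj_diff)
    also have "\<dots> \<le> (onorm P + 1) * (norm (F \<eta> - F \<xi>))\<^sup>2"
      by (intro mult_right_mono) auto
    finally have "(c' * norm (\<eta> - \<xi>))\<^sup>2 \<le> (norm (F \<eta> - F \<xi>))\<^sup>2"
      using c(1) onorm_P_nonneg by (simp add: c'_def power_mult_distrib field_simps)
    then show "c' * norm (\<eta> - \<xi>) \<le> norm (F \<eta> - F \<xi>)"
      by (rule power2_le_imp_le) simp
  qed
  then have "\<zeta> \<in> F ` Hm"
    using \<zeta> by simp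
  then obtain \<eta> where \<eta>: "\<eta> \<in> Hm" "F \<eta> = \<zeta>"
    by blast
  have "half_trajectory q a (x \<eta>)" "x \<eta> a - z \<in> Hm" "proj (x \<eta> 0) = \<zeta>"
    using half \<eta> by (simp_all add: start F_def)
  then show ?thesis
    by blast
qed

text \<open>\<open>P\<close>-compactness makes \<open>V\<close> of the differences small at time \<open>s\<close>, while equal projections
  make it nonnegative at time \<open>0\<close>; the squeezing inequality then forces the energies to be Cauchy.\<close>

lemma convergent_subseq_of_compact_P:
  assumes P: "compact_map P" and x: "\<And>k. half_trajectory q a (x k)" and s: "a \<le> s" "s < b" "b \<le> 0"
    and bdd: "bounded (range (\<lambda>k. x k s))" and \<zeta>: "\<And>k. proj (x k 0) = \<zeta>"
  shows "\<exists>\<tau>\<in>{s..b}. \<exists>r l. strict_mono (r :: nat \<Rightarrow> nat) \<and> (\<lambda>k. x (r k) \<tau>) \<longlonglongrightarrow> l"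
proof -
  obtain r p where r: "strict_mono (r :: nat \<Rightarrow> nat)" and p: "(\<lambda>k. P (x (r k) s)) \<longlonglongrightarrow> p"
    using compact_map_convergent_subseq[OF P bdd] by blast
  obtain B where B: "B > 0" "\<And>k. norm (x k s) \<le> B"
    using bdd by (auto simp: bounded_pos)
  define y where "y k = x (r k)" for k
  have half: "half_trajectory q a (y k)" for k
    by (simp add: y_def x)
  have en: "energy \<nu> {s..0} (\<lambda>t. y m t - y n t)
      \<le> ennreal (exp (2 * \<nu> * s) * (norm (P (y m s) - P (y n s)) * (2 * B)) / \<delta>)" for m n
  proof (rule energy_le_divide)
    \<comment> \<open>Only one factor has to be small: the images under \<open>P\<close> converge
      along the subsequence, while the states themselves are merely bounded by
      \<open>B\<close>.\<close>
    have "V (y m s - y n s) \<le> norm (P (y m s - y n s)) * norm (y m s - y n s)"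
      unfolding quad_form_def by (rule norm_cauchy_schwarz)
    also have "\<dots> \<le> norm (P (y m s) - P (y n s)) * (2 * B)"
      unfolding linear_diff[OF bounded_linear.linear[OF P_bounded]]
      using norm_triangle_ineq4[of "y m s" "y n s"] B(2)[of "r m"] B(2)[of "r n"]
      by (intro mult_left_mono) (auto simp: y_def)
    finally have "V (y m s - y n s) \<le> norm (P (y m s) - P (y n s)) * (2 * B)" .
    then have "exp (2 * \<nu> * s) * V (y m s - y n s)
        \<le> exp (2 * \<nu> * s) * (norm (P (y m s) - P (y n s)) * (2 * B))"
      by (intro mult_left_mono) auto
    moreover have "V (y m 0 - y n 0) \<ge> 0"
      by (rule quad_form_nonneg) (simp add: proj_diff y_def \<zeta>)
    ultimately have "exp (2 * \<nu> * s) * V (y m s - y n s) - exp (2 * \<nu> * 0) * V (y m 0 - y n 0)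
        \<le> exp (2 * \<nu> * s) * (norm (P (y m s) - P (y n s)) * (2 * B))"
      unfolding mult_zero_right exp_zero mult_1 by linarith
    moreover have "ennreal \<delta> * energy \<nu> {s..0} (\<lambda>t. y m t - y n t)
        \<le> ennreal (exp (2 * \<nu> * s) * V (y m s - y n s) - exp (2 * \<nu> * 0) * V (y m 0 - y n 0))"
      using s by (intro energy_le_half_trajectories[OF half half]) auto
    ultimately show "ennreal \<delta> * energy \<nu> {s..0} (\<lambda>t. y m t - y n t)
        \<le> ennreal (exp (2 * \<nu> * s) * (norm (P (y m s) - P (y n s)) * (2 * B)))"
      by (meson ennreal_leI order_trans)
  qed (use B in auto)
  define Q where "Q m n e \<longleftrightarrow> energy \<nu> {s..0} (\<lambda>t. y m t - y n t) \<le> ennreal e" for m n e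
  have "\<exists>N. \<forall>m\<ge>N. \<forall>n\<ge>N. Q m n e" if "e > 0" for e
  proof -
    define e' where "e' = e * \<delta> / (exp (2 * \<nu> * s) * (2 * B))"
    have "e' > 0"
      using that \<delta>_pos B by (simp add: e'_def)
    then obtain N where N: "\<And>m n. m \<ge> N \<Longrightarrow> n \<ge> N \<Longrightarrow> dist (P (y m s)) (P (y n s)) < e'"
      using LIMSEQ_imp_Cauchy[OF p] unfolding Cauchy_def y_def by blast
    have "Q m n e" if "m \<ge> N" "n \<ge> N" for m n
    proof -
      have "exp (2 * \<nu> * s) * (norm (P (y m s) - P (y n s)) * (2 * B)) / \<delta>
          \<le> exp (2 * \<nu> * s) * (e' * (2 * B)) / \<delta>"
        using N[OF that] \<delta>_pos B by (intro divide_right_mono mult_left_mono mult_right_mono) (auto simp: dist_norm)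
      also have "\<dots> = e"
        using \<delta>_pos B by (simp add: e'_def)
      finally show ?thesis
        unfolding Q_def using en[of m n] by (meson ennreal_leI order_trans)
    qed
    then show ?thesis
      by blast
  qed
  then obtain r' where r': "strict_mono (r' :: nat \<Rightarrow> nat)" "\<And>k. Q (r' (Suc k)) (r' k) ((1/4) ^ k)"
    using ex_subseq_Suc_geometric[of Q] by blast
  \<comment> \<open>The energies are Cauchy on all of \<open>{s..0}\<close>, but the time is sought
    before \<open>b\<close>, so that it can be taken arbitrarily early.\<close>
  have "\<exists>\<tau>\<in>{s..b}. \<exists>B. \<forall>k. (norm (y (r' (Suc k)) \<tau> - y (r' k) \<tau>))\<^sup>2 \<le> B * (1/2) ^ k"
  proof (rule energy_geometric_decay[OF s(2)])
    show "continuous_on {s..b} (\<lambda>t. y (r' (Suc k)) t - y (r' k) t)" for k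
      using s by (intro continuous_intros half_trajectory_continuous[OF half]) auto
    show "energy \<nu> {s..b} (\<lambda>t. y (r' (Suc k)) t - y (r' k) t) \<le> ennreal ((1/4) ^ k)" for k
      using r'(2)[of k] s unfolding Q_def by (elim order_trans[rotated]) (auto intro: energy_mono)
  qed
  then obtain \<tau> B' where \<tau>: "\<tau> \<in> {s..b}"
    and B': "\<And>k. (norm (y (r' (Suc k)) \<tau> - y (r' k) \<tau>))\<^sup>2 \<le> B' * (1/2) ^ k"
    by blast
  obtain l where "(\<lambda>k. y (r' k) \<tau>) \<longlonglongrightarrow> l"
    using convergent_of_geometric_steps[OF B'] by (auto simp: convergent_def)
  then have "strict_mono (r \<circ> r') \<and> (\<lambda>k. x ((r \<circ> r') k) \<tau>) \<longlonglongrightarrow> l"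
    using r r'(1) by (simp add: y_def strict_mono_o)
  then show ?thesis
    using \<tau> by blast
qed

section \<open>Compactness on a time window of fixed length\<close>

text \<open>Both compactness alternatives are reduced to one statement: bounded energy on a window
  yields convergence at some time inside it. The length \<open>d\<close> does not depend on the end
  \<open>b\<close>, so the windows can be moved into the far past.\<close>

lemma convergent_subseq_of_bounded_energy:
  assumes cpt: "compact_map P \<or> (\<exists>t>0. \<forall>q. compact_map (\<psi> t q))"
  obtains d where "d > 0"
    and "\<And>b x v \<zeta> C. b \<le> 0 \<Longrightarrow> (\<And>k. half_trajectory q (b - d) (x k)) \<Longrightarrow> half_trajectory q (b - d) v
      \<Longrightarrow> (\<And>k. proj (x k 0) = \<zeta>) \<Longrightarrow> (\<And>k. energy \<nu> {b - d..b} (\<lambda>s. x k s - v s) \<le> ennreal C)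
      \<Longrightarrow> \<exists>\<tau>\<in>{b - d..b}. \<exists>r l. strict_mono (r :: nat \<Rightarrow> nat) \<and> (\<lambda>k. x (r k) \<tau>) \<longlonglongrightarrow> l"
proof -
  \<comment> \<open>A time of boundedness is found in the first part of the window, leaving length
    \<open>c\<close> for compactness to act.\<close>
  have bdd: "\<exists>s\<in>{b - d..b - c}. \<exists>r. strict_mono (r :: nat \<Rightarrow> nat) \<and> bounded (range (\<lambda>k. x (r k) s))"
    if x: "\<And>k. half_trajectory q (b - d) (x k)" and v: "half_trajectory q (b - d) v" and cd: "0 \<le> c" "c < d"
      and C: "\<And>k. energy \<nu> {b - d..b} (\<lambda>s. x k s - v s) \<le> ennreal C" for b c d C and x :: "nat \<Rightarrow> real \<Rightarrow> 'h" and v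
  proof -
    have "\<exists>s\<in>{b - d..b - c}. \<exists>r. strict_mono (r :: nat \<Rightarrow> nat) \<and> bounded (range (\<lambda>k. x (r k) s - v s))"
    proof (rule energy_bounded_subseq)
      show "continuous_on {b - d..b - c} (\<lambda>s. x k s - v s)" for k
        by (intro continuous_intros half_trajectory_continuous[OF x] half_trajectory_continuous[OF v]) auto
      show "energy \<nu> {b - d..b - c} (\<lambda>s. x k s - v s) \<le> ennreal C" for k
        using C[of k] cd by (elim order_trans[rotated]) (auto intro: energy_mono)
    qed (use cd in auto)
    then obtain s and r :: "nat \<Rightarrow> nat" where s: "s \<in> {b - d..b - c}" "strict_mono r"
      and B: "bounded (range (\<lambda>k. x (r k) s - v s))"
      by blast
    have "(\<lambda>k. x (r k) s) = (\<lambda>k. (x (r k) s - v s) + v s)"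
      by simp
    then have "range (\<lambda>k. x (r k) s) = (\<lambda>y. v s + y) ` range (\<lambda>k. x (r k) s - v s)"
      by (auto simp: image_iff)
    then have "bounded (range (\<lambda>k. x (r k) s))"
      using bounded_translation[OF B, of "v s"] by simp
    then show ?thesis
      using s by blast
  qed
  from cpt show ?thesis
  proof
    assume P: "compact_map P"
    show ?thesis
    \<comment> \<open>One unit of time serves to find a bounded state, the other to find a
      convergent one.\<close>
    proof (rule that[of 2])
      fix b :: real and x :: "nat \<Rightarrow> real \<Rightarrow> 'h" and v \<zeta> C
      assume b: "b \<le> 0" and x: "\<And>k. half_trajectory q (b - 2) (x k)" and v: "half_trajectory q (b - 2) v"
        and \<zeta>: "\<And>k. proj (x k 0) = \<zeta>" and C: "\<And>k. energy \<nu> {b - 2..b} (\<lambda>s. x k s - v s) \<le> ennreal C"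
      obtain s and r :: "nat \<Rightarrow> nat" where s: "s \<in> {b - 2..b - 1}" "strict_mono r"
        and B: "bounded (range (\<lambda>k. x (r k) s))"
        using bdd[where x = x and v = v and b = b and d = 2 and c = 1 and C = C, OF x v _ _ C] by auto
      have "\<exists>\<tau>\<in>{s..b}. \<exists>r' l. strict_mono (r' :: nat \<Rightarrow> nat) \<and> (\<lambda>k. x (r (r' k)) \<tau>) \<longlonglongrightarrow> l"
        using s x \<zeta> B b by (intro convergent_subseq_of_compact_P[OF P, of q "b - 2" "\<lambda>k. x (r k)"]) auto
      then obtain \<tau> l and r' :: "nat \<Rightarrow> nat" where "\<tau> \<in> {s..b}" "strict_mono r'" "(\<lambda>k. x (r (r' k)) \<tau>) \<longlonglongrightarrow> l"
        by blast
      then show "\<exists>\<tau>\<in>{b - 2..b}. \<exists>r l. strict_mono (r :: nat \<Rightarrow> nat) \<and> (\<lambda>k. x (r k) \<tau>) \<longlonglongrightarrow> l"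
        using s strict_mono_o[OF s(2), of r'] by (intro bexI[of _ \<tau>] exI[of _ "r \<circ> r'"] exI[of _ l]) auto
    qed simp
  next
    assume "\<exists>t>0. \<forall>q. compact_map (\<psi> t q)"
    then obtain c where c: "c > 0" "\<And>q. compact_map (\<psi> c q)"
      by blast
    show ?thesis
    \<comment> \<open>One unit serves to find a bounded state at \<open>s\<close>; the compact map
      then acts over time \<open>c\<close>, and \<open>s + c\<close> is still in the window.\<close>
    proof (rule that[of "c + 1"])
      fix b :: real and x :: "nat \<Rightarrow> real \<Rightarrow> 'h" and v \<zeta> C
      assume b: "b \<le> 0" and x: "\<And>k. half_trajectory q (b - (c + 1)) (x k)" and v: "half_trajectory q (b - (c + 1)) v"
        and C: "\<And>k. energy \<nu> {b - (c + 1)..b} (\<lambda>s. x k s - v s) \<le> ennreal C"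
      obtain s and r :: "nat \<Rightarrow> nat" where s: "s \<in> {b - (c + 1)..b - c}" "strict_mono r"
        and B: "bounded (range (\<lambda>k. x (r k) s))"
        using bdd[where x = x and v = v and b = b and d = "c + 1" and c = c and C = C, OF x v _ _ C] c(1) by auto
      obtain l and r' :: "nat \<Rightarrow> nat" where r': "strict_mono r'" "(\<lambda>k. \<psi> c (\<theta> s q) (x (r (r' k)) s)) \<longlonglongrightarrow> l"
        using compact_map_convergent_subseq[OF c(2) B] by blast
      have "\<psi> c (\<theta> s q) (x k s) = x k (s + c)" for k
        using half_trajectory_step[OF x, of s "s + c" k] s c(1) by simp
      then show "\<exists>\<tau>\<in>{b - (c + 1)..b}. \<exists>r l. strict_mono (r :: nat \<Rightarrow> nat) \<and> (\<lambda>k. x (r k) \<tau>) \<longlonglongrightarrow> l"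
        using s r' c strict_mono_o[OF s(2) r'(1)] by (intro bexI[of _ "s + c"] exI[of _ "r \<circ> r'"] exI[of _ l]) auto
    qed (use c in simp)
  qed
qed

section \<open>Limits of trajectories started ever earlier\<close>

text \<open>Every time has some \<open>\<tau> n\<close> before it, so convergence propagates to all
  times and the limit inherits the cocycle relation. Fatou bounds the energy of its difference from
  \<open>v\<close>, and adding \<open>v\<close> keeps the energy finite.\<close>

lemma amenable_trajectory_limit:
  assumes v: "amenable_trajectory \<psi> \<theta> \<nu> q v"
    and x: "\<And>k. half_trajectory q (- real k) (x k)"
    and C: "\<And>k. energy \<nu> {- real k..0} (\<lambda>s. x k s - v s) \<le> ennreal C"
    and \<tau>: "\<And>n. \<tau> n \<le> - real n" and conv: "\<And>n. convergent (\<lambda>k. x k (\<tau> n))"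
  shows "\<exists>u. amenable_trajectory \<psi> \<theta> \<nu> q u \<and> (\<lambda>k. x k 0) \<longlonglongrightarrow> u 0"
proof -
  \<comment> \<open>At a time \<open>s\<close> the cocycle relation is available only once
    \<open>- real k \<le> s\<close>, hence for all large \<open>k\<close>.\<close>
  have step: "\<forall>\<^sub>F k in sequentially. x k t = \<psi> (t - s) (\<theta> s q) (x k s)" if "s \<le> t" for s t
  proof -
    have "\<forall>\<^sub>F k in sequentially. k \<ge> nat \<lceil>- s\<rceil>"
      by (rule eventually_ge_at_top)
    then show ?thesis
    proof (rule eventually_mono)
      fix k assume "k \<ge> nat \<lceil>- s\<rceil>"
      then have "- real k \<le> s"
        by linarith
      then show "x k t = \<psi> (t - s) (\<theta> s q) (x k s)"
        using that by (rule half_trajectory_step[OF x])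
    qed
  qed
  have push: "(\<lambda>k. x k t) \<longlonglongrightarrow> \<psi> (t - s) (\<theta> s q) l" if "s \<le> t" "(\<lambda>k. x k s) \<longlonglongrightarrow> l" for s t l
  proof (rule Lim_transform_eventually)
    show "(\<lambda>k. \<psi> (t - s) (\<theta> s q) (x k s)) \<longlonglongrightarrow> \<psi> (t - s) (\<theta> s q) l"
      using that by (intro cocycle_tendsto) auto
    show "\<forall>\<^sub>F k in sequentially. \<psi> (t - s) (\<theta> s q) (x k s) = x k t"
      using step[OF that(1)] by (auto elim: eventually_mono)
  qed
  define u where "u t = lim (\<lambda>k. x k t)" for t
  have u: "(\<lambda>k. x k t) \<longlonglongrightarrow> u t" for t
  proof -
    obtain n :: nat where n: "- t \<le> real n"
      using real_arch_simple by blast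
    obtain l where "(\<lambda>k. x k (\<tau> n)) \<longlonglongrightarrow> l"
      using conv[of n] by (auto simp: convergent_def)
    then have "(\<lambda>k. x k t) \<longlonglongrightarrow> \<psi> (t - \<tau> n) (\<theta> (\<tau> n) q) l"
      using \<tau>[of n] n by (intro push) auto
    then show ?thesis
      unfolding u_def by (simp add: limI)
  qed
  have u_step: "u t = \<psi> (t - s) (\<theta> s q) (u s)" if "s \<le> t" for s t
    using LIMSEQ_unique[OF u push[OF that u]] .
  have u_cont: "continuous_on {- real n..} u" for n
  proof -
    have "continuous_on {- real n..} (\<lambda>t. \<psi> (t - (- real n)) (\<theta> (- real n) q) (u (- real n)))"
      using half_trajectory_cocycle unfolding half_trajectory_def by blast
    then show ?thesis
      by (rule continuous_on_eq) (rule u_step[symmetric], simp)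
  qed
  have "isCont u t" for t
  proof -
    obtain n :: nat where n: "- t < real n"
      using reals_Archimedean2 by blast
    have "continuous_on {- real n<..} u"
      by (rule continuous_on_subset[OF u_cont[of n]]) auto
    then show ?thesis
      using n by (auto simp: continuous_on_eq_continuous_at)
  qed
  then have cont: "continuous_on UNIV u"
    by (simp add: continuous_on_eq_continuous_at)
  moreover have "u (t + s) = \<psi> t (\<theta> s q) (u s)" if "t \<ge> 0" for t s
    using u_step[of s "t + s"] that by simp
  ultimately have complete: "complete_trajectory \<psi> \<theta> q u"
    by (simp add: complete_trajectory_def)
  have v_cont: "continuous_on A v" for A
    using v by (auto simp: amenable_trajectory_def complete_trajectory_def elim: continuous_on_subset)
  have "energy \<nu> {..0} (\<lambda>s. u s - v s) \<le> ennreal C"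
  proof (rule energy_fatou)
    show "continuous_on {- real k..0} (\<lambda>s. x k s - v s)" for k
      by (intro continuous_intros v_cont half_trajectory_continuous[OF x]) auto
    show "\<forall>\<^sub>F n in sequentially. s \<in> {- real n..0}" if "s \<in> {..0}" for s
      using that eventually_ge_at_top[of "nat \<lceil>- s\<rceil>"] by (auto elim!: eventually_mono)
    show "(\<lambda>k. x k s - v s) \<longlonglongrightarrow> u s - v s" for s
      by (intro tendsto_intros u)
  qed (auto intro: C)
  then have fin: "energy \<nu> {..0} (\<lambda>s. u s - v s) < \<infinity>"
    by (rule le_less_trans) simp
  have "energy \<nu> {..0} u \<le> 2 * energy \<nu> {..0} (\<lambda>s. u s - v s) + 2 * energy \<nu> {..0} v"
    using energy_add_le[of "{..0}" "\<lambda>s. u s - v s" v \<nu>] cont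
    by (simp add: continuous_on_diff v_cont continuous_on_subset)
  also have "\<dots> < \<infinity>"
    using fin v by (simp add: amenable_trajectory_iff ennreal_mult_less_top)
  finally have "amenable_trajectory \<psi> \<theta> \<nu> q u"
    using complete by (simp add: amenable_trajectory_iff)
  then show ?thesis
    using u by blast
qed

text \<open>Trajectories through the fibre over \<open>\<zeta>\<close> are steered from ever earlier
  points of \<open>v + Hm\<close>. A diagonal subsequence then converges at arbitrarily early
  times.\<close>

lemma amenable_proj_surjective:
  assumes cpt: "compact_map P \<or> (\<exists>t>0. \<forall>q. compact_map (\<psi> t q))"
    and v: "amenable_trajectory \<psi> \<theta> \<nu> q v" and \<zeta>: "\<zeta> \<in> Hm"
  shows "\<exists>u. amenable_trajectory \<psi> \<theta> \<nu> q u \<and> proj (u 0) = \<zeta>"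
proof (rule convergent_subseq_of_bounded_energy[OF cpt, where q = q])
  fix d :: real assume d: "d > 0"
    and sub: "\<And>b y v \<zeta> C. b \<le> 0 \<Longrightarrow> (\<And>k. half_trajectory q (b - d) (y k)) \<Longrightarrow> half_trajectory q (b - d) v
      \<Longrightarrow> (\<And>k. proj (y k 0) = \<zeta>) \<Longrightarrow> (\<And>k. energy \<nu> {b - d..b} (\<lambda>s. y k s - v s) \<le> ennreal C)
      \<Longrightarrow> \<exists>\<tau>\<in>{b - d..b}. \<exists>r l. strict_mono (r :: nat \<Rightarrow> nat) \<and> (\<lambda>k. y (r k) \<tau>) \<longlonglongrightarrow> l"
  have v_half: "half_trajectory q a v" for a
    using v by (auto simp: amenable_trajectory_def complete_imp_half_trajectory)
  have "\<exists>x. half_trajectory q (- real k) x \<and> x (- real k) - v (- real k) \<in> Hm \<and> proj (x 0) = \<zeta>" for k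
    by (rule steer_from_past[OF _ \<zeta>]) simp
  then obtain x where x: "\<And>k. half_trajectory q (- real k) (x k)"
    and start: "\<And>k. x k (- real k) - v (- real k) \<in> Hm" and x0: "\<And>k. proj (x k 0) = \<zeta>"
    by metis
  \<comment> \<open>The bound is uniform in \<open>k\<close>: \<open>V\<close> of the difference is
    nonpositive at time \<open>- real k\<close>, and at least \<open>- M\<close> at time 0, where
    the projections are prescribed.\<close>
  define M where "M = onorm P * (norm (\<zeta> - proj (v 0)))\<^sup>2"
  have en: "energy \<nu> {- real k..0} (\<lambda>s. x k s - v s) \<le> ennreal (M / \<delta>)" for k
  proof (rule energy_le_divide)
    have "exp (2 * \<nu> * - real k) * V (x k (- real k) - v (- real k)) \<le> 0"
      by (intro mult_nonneg_nonpos quad_form_nonpos start) simp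
    moreover have "- M \<le> V (x k 0 - v 0)"
      using quad_form_lower[of "x k 0 - v 0"] by (simp add: M_def proj_diff x0)
    ultimately have "exp (2 * \<nu> * - real k) * V (x k (- real k) - v (- real k))
        - exp (2 * \<nu> * 0) * V (x k 0 - v 0) \<le> M"
      by simp
    moreover have "ennreal \<delta> * energy \<nu> {- real k..0} (\<lambda>s. x k s - v s)
        \<le> ennreal (exp (2 * \<nu> * - real k) * V (x k (- real k) - v (- real k))
          - exp (2 * \<nu> * 0) * V (x k 0 - v 0))"
      by (intro energy_le_half_trajectories[OF x v_half]) auto
    ultimately show "ennreal \<delta> * energy \<nu> {- real k..0} (\<lambda>s. x k s - v s) \<le> ennreal M"
      by (meson ennreal_leI order_trans)
  qed (simp add: M_def onorm_P_nonneg)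
  \<comment> \<open>The diagonal argument secures convergence at some time before
    \<open>- real n\<close> for every \<open>n\<close> at once.\<close>
  define R where "R n r \<longleftrightarrow> (\<exists>\<tau>\<le>- real n. convergent (\<lambda>k. x (r k) \<tau>))" for n and r :: "nat \<Rightarrow> nat"
  interpret subseqs R
  proof
    fix n and s :: "nat \<Rightarrow> nat" assume s: "strict_mono s"
    \<comment> \<open>Dropping the first \<open>m\<close> terms leaves trajectories that start no
      later than the left end of the window \<open>{- real n - d..- real n}\<close>.\<close>
    define m where "m = nat \<lceil>real n + d\<rceil>"
    have m: "- real (s (k + m)) \<le> - real n - d" for k
    proof -
      have "real n + d \<le> real m"
        by (simp add: m_def real_nat_ceiling_ge)
      also have "m \<le> s (k + m)"
        using seq_suble[OF s, of "k + m"] by simp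
      finally show ?thesis
        by simp
    qed
    have "\<exists>\<tau>\<in>{- real n - d..- real n}. \<exists>r l. strict_mono (r :: nat \<Rightarrow> nat)
        \<and> (\<lambda>k. x (s (r k + m)) \<tau>) \<longlonglongrightarrow> l"
    proof (rule sub)
      show "half_trajectory q (- real n - d) (x (s (k + m)))" for k
        by (rule half_trajectory_mono[OF x m])
      fix k
      have "energy \<nu> {- real n - d..- real n} (\<lambda>t. x (s (k + m)) t - v t)
          \<le> energy \<nu> {- real (s (k + m))..0} (\<lambda>t. x (s (k + m)) t - v t)"
        using m[of k] by (intro energy_mono) auto
      then show "energy \<nu> {- real n - d..- real n} (\<lambda>t. x (s (k + m)) t - v t) \<le> ennreal (M / \<delta>)"
        using en order_trans by blast
    qed (use x0 v_half in auto)
    then obtain \<tau> l and r :: "nat \<Rightarrow> nat" where \<tau>: "\<tau> \<le> - real n" "strict_mono r"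
      "(\<lambda>k. x (s (r k + m)) \<tau>) \<longlonglongrightarrow> l"
      by auto
    then have "strict_mono (\<lambda>k. r k + m)" "R n (s \<circ> (\<lambda>k. r k + m))"
      by (auto simp: R_def strict_mono_def convergent_def)
    then show "\<exists>r'. strict_mono r' \<and> R n (s \<circ> r')"
      by blast
  qed
  have "R n diagseq" for n
  proof -
    \<comment> \<open>The diagonal construction gives the property only after a shift by
      \<open>Suc n\<close>; convergence is unaffected by the shift.\<close>
    have "R n (diagseq \<circ> ((+) (Suc n)))"
    proof (rule diagseq_holds)
      fix n and r s :: "nat \<Rightarrow> nat" assume "strict_mono r" "R n s"
      then show "R n (s \<circ> r)"
        unfolding R_def using convergent_subseq_convergent[of _ r] by (fastforce simp: o_def)
    qed
    then obtain \<tau> l where \<tau>: "\<tau> \<le> - real n" and lim: "(\<lambda>k. x (diagseq (k + Suc n)) \<tau>) \<longlonglongrightarrow> l"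
      by (auto simp: R_def convergent_def add.commute)
    have "(\<lambda>k. x (diagseq k) \<tau>) \<longlonglongrightarrow> l"
      by (rule LIMSEQ_offset[OF lim])
    then show ?thesis
      unfolding R_def using \<tau> convergentI by blast
  qed
  then have "\<forall>n. \<exists>\<tau>. \<tau> \<le> - real n \<and> convergent (\<lambda>k. x (diagseq k) \<tau>)"
    by (simp add: R_def)
  then obtain \<tau> where \<tau>: "\<And>n. \<tau> n \<le> - real n" "\<And>n. convergent (\<lambda>k. x (diagseq k) (\<tau> n))"
    using choice[of "\<lambda>n \<tau>. \<tau> \<le> - real n \<and> convergent (\<lambda>k. x (diagseq k) \<tau>)"] by blast
  \<comment> \<open>The diagonal indices satisfy \<open>k \<le> diagseq k\<close>, so the reindexed
    trajectories are still defined from \<open>- real k\<close> on.\<close>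
  have ge: "- real (diagseq k) \<le> - real k" for k
    using seq_suble[OF subseq_diagseq, of k] by simp
  have "\<exists>u. amenable_trajectory \<psi> \<theta> \<nu> q u \<and> (\<lambda>k. x (diagseq k) 0) \<longlonglongrightarrow> u 0"
  proof (rule amenable_trajectory_limit[where v = v and \<tau> = \<tau>])
    show "half_trajectory q (- real k) (x (diagseq k))" for k
      by (rule half_trajectory_mono[OF x ge])
    show "energy \<nu> {- real k..0} (\<lambda>s. x (diagseq k) s - v s) \<le> ennreal (M / \<delta>)" for k
      using ge[of k] by (intro order_trans[OF energy_mono en[of "diagseq k"]]) auto
  qed (use v \<tau> in auto)
  then obtain u where u: "amenable_trajectory \<psi> \<theta> \<nu> q u" "(\<lambda>k. x (diagseq k) 0) \<longlonglongrightarrow> u 0"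
    by blast
  have "proj (u 0) = \<zeta>"
    using proj_tendsto[OF u(2)] by (simp add: x0 LIMSEQ_const_iff)
  then show ?thesis
    using u(1) by blast
qed

section \<open>The homeomorphism onto \<open>Hm\<close>\<close>

text \<open>The sequential statement \<open>tends\<close> yields both injectivity and continuity of
  the inverse. Non-emptiness supplies the reference trajectory \<open>v\<close> from which every
  point of \<open>Hm\<close> is reached.\<close>

lemma proj_homeomorphic_map:
  assumes cpt: "compact_map P \<or> (\<exists>t>0. \<forall>q. compact_map (\<psi> t q))"
    and ne: "amenable_set \<psi> \<theta> \<nu> q \<noteq> {}"
  shows "homeomorphic_map (top_of_set (amenable_set \<psi> \<theta> \<nu> q)) (top_of_set Hm) proj"
proof -
  let ?A = "amenable_set \<psi> \<theta> \<nu> q"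
  have tends: "f \<longlonglongrightarrow> l" if f: "\<And>k. f k \<in> ?A" and l: "l \<in> ?A"
    and lim: "(\<lambda>k. proj (f k)) \<longlonglongrightarrow> proj l" for f l
  proof -
    obtain v where v: "amenable_trajectory \<psi> \<theta> \<nu> q v" "v 0 = l"
      using l by (auto simp: amenable_set_def)
    have "\<forall>k. \<exists>u. amenable_trajectory \<psi> \<theta> \<nu> q u \<and> u 0 = f k"
      using f by (simp add: amenable_set_def)
    then obtain u where u: "\<And>k. amenable_trajectory \<psi> \<theta> \<nu> q (u k)" "\<And>k. u k 0 = f k"
      by (auto dest!: choice)
    show ?thesis
      using amenable_tendsto[of q u v] u v lim by simp
  qed
  have inj: "inj_on proj ?A"
  proof (rule inj_onI)
    fix x y assume "x \<in> ?A" "y \<in> ?A" "proj x = proj y"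
    \<comment> \<open>A constant sequence whose projections equal that of \<open>y\<close> converges
      to \<open>y\<close>, so its value is \<open>y\<close>.\<close>
    then have "(\<lambda>k::nat. x) \<longlonglongrightarrow> y"
      using tends[of "\<lambda>_. x" y] by simp
    then show "x = y"
      by (simp add: LIMSEQ_const_iff)
  qed
  have img: "proj ` ?A = Hm"
  proof
    show "proj ` ?A \<subseteq> Hm"
      using proj_split by auto
    obtain v where v: "amenable_trajectory \<psi> \<theta> \<nu> q v"
      using ne by (auto simp: amenable_set_def)
    show "Hm \<subseteq> proj ` ?A"
      using amenable_proj_surjective[OF cpt v] by (force simp: amenable_set_def image_iff)
  qed
  define g where "g = the_inv_into ?A proj"
  have g: "g y \<in> ?A" "proj (g y) = y" if "y \<in> Hm" for y
    using that inj img unfolding g_def by (auto intro: the_inv_into_into f_the_inv_into_f)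
  have "continuous_on Hm g"
    unfolding continuous_on_sequentially
  proof (intro allI ballI impI, elim conjE)
    fix f l assume l: "l \<in> Hm" and f: "\<forall>k. f k \<in> Hm" "f \<longlonglongrightarrow> l"
    show "(g \<circ> f) \<longlonglongrightarrow> g l"
    proof (rule tends)
      show "(\<lambda>k. proj ((g \<circ> f) k)) \<longlonglongrightarrow> proj (g l)"
        using f(2) by (simp add: g(2)[OF l] g(2)[OF f(1)[rule_format]])
    qed (use g(1) l f(1) in simp_all)
  qed
  moreover have "g (proj x) = x" if "x \<in> ?A" for x
    unfolding g_def by (rule the_inv_into_f_f[OF inj that])
  moreover have "g ` Hm \<subseteq> ?A"
    using g(1) by blast
  ultimately have "homeomorphic_maps (top_of_set ?A) (top_of_set Hm) proj g"
    using g(2) proj_continuous[of ?A] img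
    unfolding homeomorphic_maps_def by (auto simp: continuous_map_in_subtopology)
  then show ?thesis
    unfolding homeomorphic_map_maps by blast
qed

end

theorem theorem1:
  fixes \<psi> :: "real \<Rightarrow> 'q::metric_space \<Rightarrow> 'h::{real_inner, complete_space} \<Rightarrow> 'h"
    and \<theta> :: "real \<Rightarrow> 'q \<Rightarrow> 'q"
    and P :: "'h \<Rightarrow> 'h"
    and Hp Hm :: "'h set"
    and j :: nat
    and \<delta> \<nu> :: real
  assumes "separable_space (euclidean :: 'h topology)"
    and "cocycle \<psi> \<theta>"
    and "bounded_linear P" and "self_adjoint P"
    and "orthogonal_direct_sum Hp Hm"
    and "P ` Hp \<subseteq> Hp" and "P ` Hm \<subseteq> Hm"
    and "negative_on P Hm" and "positive_on P Hp"
    and "j > 0" and "dim Hm = j"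
    and "\<delta> > 0" and "\<nu> > 0"
    and "\<And>u v q l r. 0 \<le> l \<Longrightarrow> l \<le> r \<Longrightarrow>
           exp (2 * \<nu> * r) * quad_form P (\<psi> r q u - \<psi> r q v)
             - exp (2 * \<nu> * l) * quad_form P (\<psi> l q u - \<psi> l q v)
           \<le> - \<delta> * (LBINT s:{l..r}. exp (2 * \<nu> * s) * (norm (\<psi> s q u - \<psi> s q v))\<^sup>2)"
    and "\<And>q. amenable_set \<psi> \<theta> \<nu> q \<noteq> {}"
    and "compact_map P \<or> (\<exists>t_com>0. \<forall>q. compact_map (\<psi> t_com q))"
  shows "\<forall>q. homeomorphic_map (top_of_set (amenable_set \<psi> \<theta> \<nu> q)) (top_of_set Hm)
               (orthogonal_projector Hm)"
proof
  fix q
  have "dim Hm > 0"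
    using assms(10,11) by simp
  interpret squeezing_cocycle \<psi> \<theta> P Hp Hm \<delta> \<nu>
    by (rule squeezing_cocycle.intro; fact)
  show "homeomorphic_map (top_of_set (amenable_set \<psi> \<theta> \<nu> q)) (top_of_set Hm) (orthogonal_projector Hm)"
    by (rule proj_homeomorphic_map[OF assms(16) assms(15)])
qed

end
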